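(* For the CLTSP restricted to instances with arbitrary processing times, no time constraints ($r(a)=0$, $d(a)=\infty$ for all $a$) and slow clients ($0<v<1$), there is an algorithm (a dynamic program) that computes the minimum makespan of a feasible solution in $O(n^3)$ time.
   Context: An instance of the line traveling salesman problem with collaboration (CLTSP) consists of a finite set $A$ of clients, $n=|A|$, a client speed $v>0$, and for each client $a\in A$ a starting position $s(a)\in\mathbb{R}$, a release date $r(a)\in\mathbb{R}_{\ge 0}$, a deadline $d(a)\in\mathbb{R}_{\ge0}\cup\{\infty\}$ and a processing time $\tau(a)\in\mathbb{R}_{\ge0}$. A single server starts at time $0$ at position $0$ and moves along the real line with speed at most $1$ (it may wait). Client $a$ is at position $s(a)$ at time $r(a)$ and from then on can move along the line with speed at most $v$ (or wait). A solution is a pair $(t,x)$ of maps $t:A\to\mathbb{R}_{\ge0}$, $x:A\to\mathbb{R}$, where $(t(a),x(a))$ is the time and position of the rendezvous of the server with client $a$. Let $\sigma_1,\dots,\sigma_n$ be the clients ordered by rendezvous time, put $(t_i,x_i)=(t(\sigma_i),x(\sigma_i))$ for $1\le i\le n$, $(t_0,x_0)=(0,0)$, and let $(t_{n+1},x_{n+1})$ be the time and position at which the server ends. Completion times are $c_0=0$, $c_i=t_i+\tau(\sigma_i)$ for $1\le i\le n$, $c_{n+1}=t_{n+1}$. The solution is feasible if $x_{n+1}=0$; $t_i\ge c_{i-1}+|x_i-x_{i-1}|$ for all $1\le i\le n+1$; $t(a)\ge r(a)+|x(a)-s(a)|/v$ for all $a\in A$; and $r(a)\le t(a)\le d(a)$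 for all $a$. The makespan is $C_{\max}(t,x)=c_{n+1}$; the CLTSP asks for a feasible solution of minimum makespan. *)

theory Defs
  imports Complex_Main "HOL-Library.Extended_Real" "HOL-Library.Landau_Symbols"
begin

section \<open>The line traveling salesman problem with collaboration\<close>

record 'a cltsp =
  clients :: "'a set"
  speed :: real
  start :: "'a \<Rightarrow> real"
  release :: "'a \<Rightarrow> real"
  deadline :: "'a \<Rightarrow> ereal"
  proc_time :: "'a \<Rightarrow> real"

definition cltsp_instance :: "'a cltsp \<Rightarrow> bool" where
  "cltsp_instance I \<longleftrightarrow> finite (clients I) \<and> speed I > 0 \<and>
     (\<forall>a\<in>clients I. release I a \<ge> 0 \<and> deadline I a \<ge> 0 \<and> proc_time I a \<ge> 0)"

definition num_clients :: "'a cltsp \<Rightarrow> nat" where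
  "num_clients I = card (clients I)"

definition no_time_constraints :: "'a cltsp \<Rightarrow> bool" where
  "no_time_constraints I \<longleftrightarrow>
     (\<forall>a\<in>clients I. release I a = 0 \<and> deadline I a = \<infinity>)"

definition slow_clients :: "'a cltsp \<Rightarrow> bool" where
  "slow_clients I \<longleftrightarrow> 0 < speed I \<and> speed I < 1"

text \<open>
  The maps \<open>rdv_time\<close> and \<open>rdv_pos\<close> do not determine when and where the server ends its tour,
  so both are components of a solution. Values of the maps outside the client set are irrelevant.
\<close>

record 'a solution =
  rdv_time :: "'a \<Rightarrow> real"
  rdv_pos :: "'a \<Rightarrow> real"
  end_time :: real
  end_pos :: real

definition rdv_order :: "'a cltsp \<Rightarrow> 'a solution \<Rightarrow> (nat \<Rightarrow> 'a) \<Rightarrow> bool" where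
  "rdv_order I S \<sigma> \<longleftrightarrow> bij_betw \<sigma> {1..num_clients I} (clients I) \<and>
     mono_on {1..num_clients I} (\<lambda>i. rdv_time S (\<sigma> i))"

text \<open>
  For a fixed order \<open>\<sigma>\<close>, these are $t_i$, $x_i$ and $c_i$ for $0 \le i \le n+1$.
\<close>

definition stop_time :: "'a cltsp \<Rightarrow> 'a solution \<Rightarrow> (nat \<Rightarrow> 'a) \<Rightarrow> nat \<Rightarrow> real" where
  "stop_time I S \<sigma> i =
     (if i = 0 then 0 else if i \<le> num_clients I then rdv_time S (\<sigma> i) else end_time S)"

definition stop_pos :: "'a cltsp \<Rightarrow> 'a solution \<Rightarrow> (nat \<Rightarrow> 'a) \<Rightarrow> nat \<Rightarrow> real" where
  "stop_pos I S \<sigma> i =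
     (if i = 0 then 0 else if i \<le> num_clients I then rdv_pos S (\<sigma> i) else end_pos S)"

definition completion_time :: "'a cltsp \<Rightarrow> 'a solution \<Rightarrow> (nat \<Rightarrow> 'a) \<Rightarrow> nat \<Rightarrow> real" where
  "completion_time I S \<sigma> i =
     stop_time I S \<sigma> i + (if 1 \<le> i \<and> i \<le> num_clients I then proc_time I (\<sigma> i) else 0)"

text \<open>
  Clients with equal rendezvous times may be ordered either way; the tour has to be feasible for
  one of the possible orders.
\<close>

definition feasible :: "'a cltsp \<Rightarrow> 'a solution \<Rightarrow> bool" where
  "feasible I S \<longleftrightarrow>
     end_pos S = 0 \<and>
     (\<exists>\<sigma>. rdv_order I S \<sigma> \<and>
        (\<forall>i\<in>{1..num_clients I + 1}.
           stop_time I S \<sigma> i \<ge>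
             completion_time I S \<sigma> (i - 1) + \<bar>stop_pos I S \<sigma> i - stop_pos I S \<sigma> (i - 1)\<bar>)) \<and>
     (\<forall>a\<in>clients I.
        rdv_time S a \<ge> 0 \<and>
        rdv_time S a \<ge> release I a + \<bar>rdv_pos S a - start I a\<bar> / speed I \<and>
        release I a \<le> rdv_time S a \<and> ereal (rdv_time S a) \<le> deadline I a)"

text \<open>
  This is $c_{n+1} = t_{n+1}$, which does not depend on the order.
\<close>

definition makespan :: "'a solution \<Rightarrow> real" where
  "makespan S = end_time S"


section \<open>A real RAM\<close>

text \<open>
  The memory consists of infinitely many cells holding natural numbers, which are used for counting
  and for indirect addressing, and infinitely many cells holding real numbers. Every expression
  node that is evaluated costs one time unit, and so does every store, branch and loop test.
  Real arithmetic is exact, with the convention $x / 0 = 0$. There is no rounding and no conversion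
  of reals to naturals, natural numbers can only be added, subtracted (truncated at 0) and compared,
  and only integers are available as real constants, so that a program cannot contain an infinite
  amount of precomputed information.
\<close>

datatype nexp =
    NConst nat
  | NMem nexp
  | NAdd nexp nexp
  | NSub nexp nexp

datatype rexp =
    RConst int
  | RMem nexp
  | RAdd rexp rexp
  | RSub rexp rexp
  | RMul rexp rexp
  | RDiv rexp rexp

datatype bexp =
    NLess nexp nexp
  | RLess rexp rexp
  | BNot bexp
  | BAnd bexp bexp

datatype com =
    Skip
  | NStore nexp nexp
  | RStore nexp rexp
  | Seq com com
  | Cond bexp com com
  | While bexp com

record mem =
  nmem :: "nat \<Rightarrow> nat"
  rmem :: "nat \<Rightarrow> real"

fun nval :: "nexp \<Rightarrow> mem \<Rightarrow> nat" where
  "nval (NConst k) m = k"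
| "nval (NMem e) m = nmem m (nval e m)"
| "nval (NAdd e f) m = nval e m + nval f m"
| "nval (NSub e f) m = nval e m - nval f m"

fun rval :: "rexp \<Rightarrow> mem \<Rightarrow> real" where
  "rval (RConst k) m = of_int k"
| "rval (RMem e) m = rmem m (nval e m)"
| "rval (RAdd e f) m = rval e m + rval f m"
| "rval (RSub e f) m = rval e m - rval f m"
| "rval (RMul e f) m = rval e m * rval f m"
| "rval (RDiv e f) m = rval e m / rval f m"

fun bval :: "bexp \<Rightarrow> mem \<Rightarrow> bool" where
  "bval (NLess e f) m \<longleftrightarrow> nval e m < nval f m"
| "bval (RLess e f) m \<longleftrightarrow> rval e m < rval f m"
| "bval (BNot b) m \<longleftrightarrow> \<not> bval b m"
| "bval (BAnd b c) m \<longleftrightarrow> bval b m \<and> bval c m"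

fun ncost :: "nexp \<Rightarrow> nat" where
  "ncost (NConst k) = 1"
| "ncost (NMem e) = 1 + ncost e"
| "ncost (NAdd e f) = 1 + ncost e + ncost f"
| "ncost (NSub e f) = 1 + ncost e + ncost f"

fun rcost :: "rexp \<Rightarrow> nat" where
  "rcost (RConst k) = 1"
| "rcost (RMem e) = 1 + ncost e"
| "rcost (RAdd e f) = 1 + rcost e + rcost f"
| "rcost (RSub e f) = 1 + rcost e + rcost f"
| "rcost (RMul e f) = 1 + rcost e + rcost f"
| "rcost (RDiv e f) = 1 + rcost e + rcost f"

fun bcost :: "bexp \<Rightarrow> nat" where
  "bcost (NLess e f) = 1 + ncost e + ncost f"
| "bcost (RLess e f) = 1 + rcost e + rcost f"
| "bcost (BNot b) = 1 + bcost b"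
| "bcost (BAnd b c) = 1 + bcost b + bcost c"

text \<open>
  \<open>exec c m k m'\<close>: started in memory \<open>m\<close>, the program \<open>c\<close> terminates after exactly \<open>k\<close> time
  units in memory \<open>m'\<close>.
\<close>

inductive exec :: "com \<Rightarrow> mem \<Rightarrow> nat \<Rightarrow> mem \<Rightarrow> bool" where
  exec_Skip: "exec Skip m 1 m"
| exec_NStore:
    "exec (NStore a e) m (1 + ncost a + ncost e) (m\<lparr>nmem := (nmem m)(nval a m := nval e m)\<rparr>)"
| exec_RStore:
    "exec (RStore a e) m (1 + ncost a + rcost e) (m\<lparr>rmem := (rmem m)(nval a m := rval e m)\<rparr>)"
| exec_Seq:
    "exec c m k m' \<Longrightarrow> exec d m' l m'' \<Longrightarrow> exec (Seq c d) m (k + l) m''"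
| exec_CondTrue:
    "bval b m \<Longrightarrow> exec c m k m' \<Longrightarrow> exec (Cond b c d) m (1 + bcost b + k) m'"
| exec_CondFalse:
    "\<not> bval b m \<Longrightarrow> exec d m k m' \<Longrightarrow> exec (Cond b c d) m (1 + bcost b + k) m'"
| exec_WhileFalse:
    "\<not> bval b m \<Longrightarrow> exec (While b c) m (1 + bcost b) m"
| exec_WhileTrue:
    "bval b m \<Longrightarrow> exec c m k m' \<Longrightarrow> exec (While b c) m' l m'' \<Longrightarrow>
     exec (While b c) m (1 + bcost b + k + l) m''"

inductive_cases exec_SkipE: "exec Skip m k m'"
inductive_cases exec_NStoreE: "exec (NStore a e) m k m'"
inductive_cases exec_RStoreE: "exec (RStore a e) m k m'"
inductive_cases exec_SeqE: "exec (Seq c d) m k m'"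
inductive_cases exec_CondE: "exec (Cond b c d) m k m'"
inductive_cases exec_WhileE: "exec (While b c) m k m'"

lemma exec_deterministic:
  "exec c m k m' \<Longrightarrow> exec c m l m'' \<Longrightarrow> k = l \<and> m' = m''"
proof (induction arbitrary: l m'' rule: exec.induct)
  case (exec_Skip m)
  then show ?case by (rule exec_SkipE) simp
next
  case (exec_NStore a e m)
  then show ?case by (rule exec_NStoreE) simp
next
  case (exec_RStore a e m)
  then show ?case by (rule exec_RStoreE) simp
next
  case (exec_Seq c m k m1 d l1 m2)
  from exec_Seq.prems show ?case
    by (rule exec_SeqE) (metis exec_Seq.IH)
next
  case (exec_CondTrue b m c k m1 d)
  from exec_CondTrue.prems show ?case
    by (rule exec_CondE) (auto simp: exec_CondTrue.hyps(1) dest!: exec_CondTrue.IH)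
next
  case (exec_CondFalse b m d k m1 c)
  from exec_CondFalse.prems show ?case
    by (rule exec_CondE) (auto simp: exec_CondFalse.hyps(1) dest!: exec_CondFalse.IH)
next
  case (exec_WhileFalse b m c)
  from exec_WhileFalse.prems show ?case
    by (rule exec_WhileE) (simp_all add: exec_WhileFalse.hyps)
next
  case (exec_WhileTrue b m c k m1 l1 m2)
  from exec_WhileTrue.prems show ?case
    by (rule exec_WhileE) (auto simp: exec_WhileTrue.hyps(1) dest!: exec_WhileTrue.IH)
qed

text \<open>
  The clients are presented to the machine as a list \<open>cs\<close> in arbitrary order: natural cell 0 holds
  $n$, real cell 0 holds $v$, the cells $1,\dots,n$ hold the starting positions and the cells
  $n+1,\dots,2n$ the processing times. All other cells are 0. Release dates and deadlines are not
  part of the input, since they are constant on instances without time constraints.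
\<close>

definition input_mem :: "'a cltsp \<Rightarrow> 'a list \<Rightarrow> mem" where
  "input_mem I cs =
     (let n = length cs in
      \<lparr>nmem = (\<lambda>i. if i = 0 then n else 0),
       rmem = (\<lambda>i. if i = 0 then speed I
                   else if i \<le> n then start I (cs ! (i - 1))
                   else if i \<le> 2 * n then proc_time I (cs ! (i - n - 1))
                   else 0)\<rparr>)"

definition result :: "mem \<Rightarrow> real" where
  "result m = rmem m 0"

end

theory Submission
  imports Defs
begin

text \<open>
  Sort the clients by starting position. Serving a client that can already stand next to the server
  costs no travel time and is never harmful, so the server may serve such clients immediately. Once
  nobody is available, the served clients are exactly those strictly between the next unserved
  client \<open>i\<close> on the left and the next unserved client \<open>j\<close> on the right, and the server walks towards
  \<open>i\<close> or towards \<open>j\<close>. Meeting the client at time \<open>t\<close> fixes the position \<open>s i + v t\<close> or \<open>s j - v t\<close>, and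
  since \<open>v < 1\<close> an earlier meeting is better: the server can escort the client until any later time.
  It therefore suffices to know the earliest meeting time for each of the $O(n^2)$ pairs and both sides,
  and each of them is propagated in $O(n)$ steps.

  A client from the right may well cross the origin and be served on the left, so it is not enough
  to consider tours that serve every client on its own side.
\<close>

section \<open>Schedules and dominance\<close>

locale line =
  fixes n :: nat and v :: real and s \<tau> :: "nat \<Rightarrow> real"
  assumes v: "0 < v" "v < 1"
    and tau_nonneg: "\<And>k. k \<in> {1..n} \<Longrightarrow> 0 \<le> \<tau> k"
begin

text \<open>
  \<open>served A c x\<close>: some schedule serves exactly the clients in \<open>A\<close> and leaves the server at
  position \<open>x\<close> at time \<open>c\<close>, the moment the last processing is completed.
\<close>

inductive served :: "nat set \<Rightarrow> real \<Rightarrow> real \<Rightarrow> bool" where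
  served_empty: "served {} 0 0"
| served_insert: "served (insert k A) (t + \<tau> k) y"
    if "served A c x" "k \<in> {1..n} - A" "c + \<bar>y - x\<bar> \<le> t" "\<bar>y - s k\<bar> \<le> v * t"

lemma served_subset: "served A c x \<Longrightarrow> A \<subseteq> {1..n}"
  by (induction rule: served.induct) auto

lemma served_nonneg: "served A c x \<Longrightarrow> 0 \<le> c"
proof (induction rule: served.induct)
  case (served_insert A c x k y t)
  then show ?case using tau_nonneg[of k] by auto
qed simp

lemma ex_served: "\<exists>c x. served {1..n} c x"
proof -
  have "\<exists>c x. served {1..m} c x" if "m \<le> n" for m
    using that
  proof (induction m)
    case 0
    then show ?case using served_empty by auto
  next
    case (Suc m)
    then obtain c x where "served {1..m} c x" by auto
    then have "served (insert (Suc m) {1..m}) (max c (\<bar>x - s (Suc m)\<bar> / v) + \<tau> (Suc m)) x"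
      using Suc.prems v by (intro served_insert) (auto simp: field_simps max_def)
    then show ?case by (metis atLeastAtMostSuc_conv le_add1 plus_1_eq_Suc)
  qed
  then show ?thesis by auto
qed

text \<open>
  The server and the client approach each other with relative speed \<open>1 + v\<close>; at time \<open>c\<close> the client
  has already covered the distance \<open>v * c\<close>.
\<close>

definition meetL :: "nat \<Rightarrow> real \<Rightarrow> real \<Rightarrow> real" where
  "meetL i c x = c + (x - s i - v * c) / (1 + v)"

definition meetR :: "nat \<Rightarrow> real \<Rightarrow> real \<Rightarrow> real" where
  "meetR j c x = c + (s j - x - v * c) / (1 + v)"

definition stuck :: "nat \<Rightarrow> nat \<Rightarrow> real \<Rightarrow> real \<Rightarrow> bool" where
  "stuck i j c x \<longleftrightarrow> (0 < i \<longrightarrow> v * c < x - s i) \<and> (j \<le> n \<longrightarrow> v * c < s j - x)"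

text \<open>
  Table entries are numbered such that every transition leads to a larger number.
\<close>

definition index :: "nat \<Rightarrow> nat \<Rightarrow> nat" where
  "index i j = (n - i) * (n + 2) + j"

text \<open>
  The entries of \<open>L\<close> and \<open>R\<close> for \<open>(i, j)\<close> are the earliest known times at which the server meets client
  \<open>i + 1\<close> or \<open>j - 1\<close> as the last of \<open>{i<..<j}\<close>, and \<open>b\<close> is the best makespan. They are stored as
  \<open>1 + t\<close>, so that the initial value 0 of a memory cell stands for \<open>\<infinity>\<close>.
\<close>

definition covered :: "(nat \<Rightarrow> real) \<Rightarrow> (nat \<Rightarrow> real) \<Rightarrow> real \<Rightarrow> nat \<Rightarrow> nat \<Rightarrow> real \<Rightarrow> real \<Rightarrow> bool" where
  "covered L R b i j c x \<longleftrightarrow>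
     (0 < i \<longrightarrow> 0 < L (index (i - 1) j) \<and> L (index (i - 1) j) \<le> 1 + meetL i c x) \<and>
     (j \<le> n \<longrightarrow> 0 < R (index i (j + 1)) \<and> R (index i (j + 1)) \<le> 1 + meetR j c x) \<and>
     (i = 0 \<and> n < j \<longrightarrow> 0 < b \<and> b \<le> 1 + (c + \<bar>x\<bar>))"

text \<open>
  A meeting at time \<open>t\<close> and position \<open>x\<close>, before which the clients in \<open>H\<close> have been served, has been
  propagated: all clients that become available at \<open>x\<close> are served there, and the server then walks on.
\<close>

definition settled ::
  "(nat \<Rightarrow> real) \<Rightarrow> (nat \<Rightarrow> real) \<Rightarrow> real \<Rightarrow> nat set \<Rightarrow> real \<Rightarrow> real \<Rightarrow> nat \<Rightarrow> nat \<Rightarrow> bool" where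
  "settled L R b H t x i j \<longleftrightarrow>
     (\<exists>i' j' c. i' \<le> i \<and> j \<le> j' \<and> i' < j' \<and> j' \<le> n + 1 \<and>
        c = t + sum \<tau> ({i'<..<j'} - H) \<and> stuck i' j' c x \<and> covered L R b i' j' c x)"

definition processed :: "(nat \<Rightarrow> real) \<Rightarrow> (nat \<Rightarrow> real) \<Rightarrow> real \<Rightarrow> nat \<Rightarrow> nat \<Rightarrow> bool" where
  "processed L R b i j \<longleftrightarrow>
     (0 < L (index i j) \<longrightarrow>
        settled L R b {i + 1<..<j} (L (index i j) - 1) (s (i + 1) + v * (L (index i j) - 1)) i j) \<and>
     (0 < R (index i j) \<longrightarrow>
        settled L R b {i<..<j - 1} (R (index i j) - 1) (s (j - 1) - v * (R (index i j) - 1)) i j)"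

text \<open>
  Walking towards the client at \<open>w\<close> does not delay a rendezvous with it at \<open>X\<close>: after the meeting at
  time \<open>m\<close>, the server can escort the client to \<open>X\<close>.
\<close>

lemma meet_dom:
  assumes "c + \<bar>x - X\<bar> \<le> T" "w - X \<le> v * T" "v * c < w - x"
    and "m \<le> c + (w - x - v * c) / (1 + v)"
  shows "m + \<bar>(w - v * m) - X\<bar> \<le> T"
proof -
  define y where "y = (w - x - v * c) / (1 + v)"
  have y: "0 \<le> y" "x + y = w - v * (c + y)"
    using v assms(3) by (auto simp: y_def field_simps)
  have 1: "c + y + \<bar>x + y - X\<bar> \<le> T"
  proof (cases "x + y \<le> X")
    case True
    then show ?thesis using assms(1) by linarith
  next
    case False
    have "x + y - X \<le> (x + y - X) / v"
      using False v mult_left_le[of v "x + y - X"] by (simp add: pos_le_divide_eq)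
    moreover have "(x + y - X) / v = (w - X) / v - (c + y)"
      using v y(2) by (simp add: field_simps)
    moreover have "(w - X) / v \<le> T" using assms(2) v by (simp add: field_simps)
    ultimately show ?thesis using False by linarith
  qed
  have m: "m \<le> c + y" using assms(4) by (simp add: y_def)
  have "\<bar>(w - v * m) - (x + y)\<bar> = v * (c + y - m)"
    using y(2) m v by (simp add: abs_mult right_diff_distrib[symmetric] flip: abs_of_pos)
  also have "\<dots> \<le> 1 * (c + y - m)" using m v by (intro mult_right_mono) auto
  finally have "\<bar>(w - v * m) - (x + y)\<bar> \<le> c + y - m" by simp
  moreover have "\<bar>(w - v * m) - X\<bar> \<le> \<bar>(w - v * m) - (x + y)\<bar> + \<bar>x + y - X\<bar>" by linarith
  ultimately show ?thesis using 1 by linarith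
qed

lemma meetR_dom:
  assumes "c + \<bar>x - X\<bar> \<le> T" "s j - X \<le> v * T" "v * c < s j - x" "m \<le> meetR j c x"
  shows "m + \<bar>(s j - v * m) - X\<bar> \<le> T"
  using meet_dom[OF assms(1-3)] assms(4) by (simp add: meetR_def)

lemma meetL_dom:
  assumes "c + \<bar>x - X\<bar> \<le> T" "X - s i \<le> v * T" "v * c < x - s i" "m \<le> meetL i c x"
  shows "m + \<bar>(s i + v * m) - X\<bar> \<le> T"
proof -
  have "c + \<bar>- x - - X\<bar> \<le> T" using assms(1) by linarith
  then have "m + \<bar>(- s i - v * m) - - X\<bar> \<le> T"
    using assms by (intro meet_dom[of c "- x"]) (auto simp: meetL_def)
  then show ?thesis by linarith
qed

lemma sum_minus_insert:
  assumes "k \<in> H" "k \<notin> A" "finite H"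
  shows "sum \<tau> (H - A) = \<tau> k + sum \<tau> (H - insert k A)"
proof -
  have "H - A = insert k (H - insert k A)" using assms by auto
  then show ?thesis using assms by (metis Diff_iff finite_Diff insertI1 sum.insert)
qed

lemma sum_minus_trans:
  assumes "A \<subseteq> G" "G \<subseteq> H" "finite H"
  shows "sum \<tau> (H - A) = sum \<tau> (G - A) + sum \<tau> (H - G)"
proof -
  have "H - A = (G - A) \<union> (H - G)" using assms by auto
  then show ?thesis using assms by (simp add: sum.union_disjoint finite_subset Int_Diff Diff_Int_distrib2
     disjoint_iff)
qed

definition dominated :: "(nat \<Rightarrow> real) \<Rightarrow> (nat \<Rightarrow> real) \<Rightarrow> real \<Rightarrow> nat set \<Rightarrow> real \<Rightarrow> real \<Rightarrow> bool" where
  "dominated L R b A T X \<longleftrightarrow>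
     (\<exists>i j c x. A \<subseteq> {i<..<j} \<and> i < j \<and> j \<le> n + 1 \<and> stuck i j c x \<and> covered L R b i j c x \<and>
        c + \<bar>x - X\<bar> \<le> T + sum \<tau> ({i<..<j} - A))"

end

locale sorted_line = line +
  assumes sorted: "\<And>i j. 1 \<le> i \<Longrightarrow> i \<le> j \<Longrightarrow> j \<le> n \<Longrightarrow> s i \<le> s j"
begin

lemma dominated_insert:
  assumes processed: "\<And>i j. i \<le> n \<Longrightarrow> j \<le> n + 1 \<Longrightarrow> processed L R b i j"
    and "A \<subseteq> {i<..<j}" "i < j" "j \<le> n + 1" "stuck i j c x" "covered L R b i j c x"
    and "c + \<bar>x - X\<bar> \<le> T + sum \<tau> ({i<..<j} - A)"
    and k: "k \<in> {1..n} - A" "\<bar>X - s k\<bar> \<le> v * T"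
  shows "dominated L R b (insert k A) (T + \<tau> k) X"
  using assms(2-7)
proof (induction "n + 1 - j + i" arbitrary: i j c x rule: less_induct)
  case less
  let ?H = "{i<..<j}"
  have tauH: "0 \<le> sum \<tau> (?H - A)"
    using less.prems(3) by (intro sum_nonneg tau_nonneg) auto
  then have reach: "\<bar>X - s k\<bar> \<le> v * (T + sum \<tau> (?H - A))"
    using k(2) v mult_left_mono[of T "T + sum \<tau> (?H - A)" v] by linarith
  have next_state: ?case
    if "settled L R b ?H m y i' j'" "m + \<bar>y - X\<bar> \<le> T + sum \<tau> (?H - A)"
       "i' \<le> i" "j \<le> j'" "i' < i \<or> j < j'" for m y i' j'
  proof -
    from that(1) obtain i2 j2 c2 where *: "i2 \<le> i'" "j' \<le> j2" "i2 < j2" "j2 \<le> n + 1"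
      "c2 = m + sum \<tau> ({i2<..<j2} - ?H)" "stuck i2 j2 c2 y" "covered L R b i2 j2 c2 y"
      unfolding settled_def by auto
    have sub: "?H \<subseteq> {i2<..<j2}" using * that by auto
    have dom: "c2 + \<bar>y - X\<bar> \<le> T + sum \<tau> ({i2<..<j2} - A)"
      using sum_minus_trans[OF less.prems(1) sub] *(5) that(2) by simp
    show ?case
      using less.hyps[of j2 i2 c2 y] * that less.prems sub dom by auto
  qed
  show ?case
  proof (cases "k \<in> ?H")
    case True
    then show ?thesis
      unfolding dominated_def using less.prems k sum_minus_insert[of k ?H A]
      by (intro exI[of _ i] exI[of _ j] exI[of _ c] exI[of _ x]) auto
  next
    case False
    then consider "k \<le> i" | "j \<le> k" by fastforce
    then show ?thesis
    proof cases
      case 1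
      then have i: "0 < i" "s k \<le> s i" using k less.prems sorted[of k i] by auto
      define m where "m = L (index (i - 1) j) - 1"
      have m: "0 < m + 1" "m \<le> meetL i c x"
        using less.prems(5) i unfolding covered_def m_def by auto
      have "settled L R b ?H m (s i + v * m) (i - 1) j"
        using processed[of "i - 1" j] less.prems i m unfolding processed_def m_def by auto
      moreover have "m + \<bar>(s i + v * m) - X\<bar> \<le> T + sum \<tau> (?H - A)"
        using less.prems i m reach by (intro meetL_dom[OF less.prems(6)]) (auto simp: stuck_def)
      ultimately show ?thesis
        using i by (intro next_state[of m _ "i - 1" j]) auto
    next
      case 2
      then have j: "j \<le> n" "s j \<le> s k" using k less.prems sorted[of j k] by auto
      define m where "m = R (index i (j + 1)) - 1"
      have m: "0 < m + 1" "m \<le> meetR j c x"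
        using less.prems(5) j unfolding covered_def m_def by auto
      have "settled L R b ?H m (s j - v * m) i (j + 1)"
        using processed[of i "j + 1"] less.prems j m unfolding processed_def m_def by auto
      moreover have "m + \<bar>(s j - v * m) - X\<bar> \<le> T + sum \<tau> (?H - A)"
        using less.prems j m reach by (intro meetR_dom[OF less.prems(6)]) (auto simp: stuck_def)
      ultimately show ?thesis
        using j by (intro next_state[of m _ i "j + 1"]) auto
    qed
  qed
qed

lemma served_dominated:
  assumes processed: "\<And>i j. i \<le> n \<Longrightarrow> j \<le> n + 1 \<Longrightarrow> processed L R b i j"
    and init: "settled L R b {} 0 0 i0 j0"
    and "served A T X"
  shows "dominated L R b A T X"
  using assms(3)
proof (induction rule: served.induct)
  case served_empty
  from init obtain i j where "i < j" "j \<le> n + 1" "stuck i j (sum \<tau> {i<..<j}) 0"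
    "covered L R b i j (sum \<tau> {i<..<j}) 0"
    unfolding settled_def by auto
  then show ?case
    unfolding dominated_def
    by (intro exI[of _ i] exI[of _ j] exI[of _ "sum \<tau> {i<..<j}"] exI[of _ 0]) auto
next
  case (served_insert A T X k Y t)
  from served_insert.IH obtain i j c x where *: "A \<subseteq> {i<..<j}" "i < j" "j \<le> n + 1" "stuck i j c x"
    "covered L R b i j c x" "c + \<bar>x - X\<bar> \<le> T + sum \<tau> ({i<..<j} - A)"
    unfolding dominated_def by auto
  show ?case
    using * served_insert.hyps by (intro dominated_insert[OF processed *(1-5)]) auto
qed

lemma optimum_bound:
  assumes "\<And>i j. i \<le> n \<Longrightarrow> j \<le> n + 1 \<Longrightarrow> processed L R b i j"
    and "settled L R b {} 0 0 i0 j0" "served {1..n} T X"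
  shows "0 < b \<and> b \<le> 1 + (T + \<bar>X\<bar>)"
proof -
  from served_dominated[OF assms] obtain i j c x where *: "{1..n} \<subseteq> {i<..<j}" "i < j" "j \<le> n + 1"
    "covered L R b i j c x" "c + \<bar>x - X\<bar> \<le> T + sum \<tau> ({i<..<j} - {1..n})"
    unfolding dominated_def by auto
  have "i = 0 \<and> n < j"
  proof (cases "n = 0")
    case False
    then have "1 \<in> {i<..<j}" "n \<in> {i<..<j}"
      by (auto intro!: subsetD[OF *(1)] simp del: greaterThanLessThan_iff)
    then show ?thesis by auto
  qed (use * in auto)
  moreover from this * have "{i<..<j} - {1..n} = {}" by auto
  with *(5) have "c + \<bar>x - X\<bar> \<le> T + sum \<tau> {}" by (simp only:)
  ultimately show ?thesis using *(4) unfolding covered_def by auto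
qed

end

section \<open>Schedules as feasible solutions\<close>

locale unconstrained =
  fixes I :: "'a cltsp" and \<pi> :: "nat \<Rightarrow> 'a"
  assumes inst: "cltsp_instance I" "no_time_constraints I" "slow_clients I"
    and bij: "bij_betw \<pi> {1..num_clients I} (clients I)"
begin

sublocale line "num_clients I" "speed I" "\<lambda>k. start I (\<pi> k)" "\<lambda>k. proc_time I (\<pi> k)"
proof
  show "0 < speed I" "speed I < 1" using inst by (auto simp: slow_clients_def)
next
  fix k assume "k \<in> {1..num_clients I}"
  then show "0 \<le> proc_time I (\<pi> k)"
    using inst bij_betwE[OF bij] by (auto simp: cltsp_instance_def)
qed

definition schedules ::
  "'a solution \<Rightarrow> (nat \<Rightarrow> nat) \<Rightarrow> nat set \<Rightarrow> real \<Rightarrow> real \<Rightarrow> bool" where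
  "schedules S \<rho> A c x \<longleftrightarrow> bij_betw \<rho> {1..card A} A \<and>
    (\<forall>i\<in>{1..card A}. completion_time I S (\<pi> \<circ> \<rho>) (i - 1) +
       \<bar>stop_pos I S (\<pi> \<circ> \<rho>) i - stop_pos I S (\<pi> \<circ> \<rho>) (i - 1)\<bar> \<le> stop_time I S (\<pi> \<circ> \<rho>) i) \<and>
    (\<forall>k\<in>A. \<bar>rdv_pos S (\<pi> k) - start I (\<pi> k)\<bar> \<le> speed I * rdv_time S (\<pi> k)) \<and>
    completion_time I S (\<pi> \<circ> \<rho>) (card A) = c \<and> stop_pos I S (\<pi> \<circ> \<rho>) (card A) = x"

lemma served_schedules: "served A c x \<Longrightarrow> \<exists>S \<rho>. schedules S \<rho> A c x"
proof (induction rule: served.induct)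
  case served_empty
  show ?case
    by (auto simp: schedules_def completion_time_def stop_time_def stop_pos_def bij_betw_def)
next
  case (served_insert A c x k y t)
  define n where "n = num_clients I"
  define m where "m = card A"
  have A: "A \<subseteq> {1..n}" "finite A"
    using served_subset[OF served_insert.hyps(1)] by (auto simp: n_def intro: finite_subset)
  have card: "card (insert k A) = Suc m"
    using A served_insert.hyps by (simp add: m_def)
  have "card (insert k A) \<le> card {1..n}"
    using A served_insert.hyps by (intro card_mono) (auto simp: n_def)
  then have mn: "Suc m \<le> n" using card by simp
  from served_insert.IH obtain S \<rho> where "schedules S \<rho> A c x" by blast
  then have *: "bij_betw \<rho> {1..m} A"
    "\<And>i. i \<in> {1..m} \<Longrightarrow> completion_time I S (\<pi> \<circ> \<rho>) (i - 1) +
       \<bar>stop_pos I S (\<pi> \<circ> \<rho>) i - stop_pos I S (\<pi> \<circ> \<rho>) (i - 1)\<bar> \<le> stop_time I S (\<pi> \<circ> \<rho>) i"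
    "\<And>k. k \<in> A \<Longrightarrow> \<bar>rdv_pos S (\<pi> k) - start I (\<pi> k)\<bar> \<le> speed I * rdv_time S (\<pi> k)"
    "completion_time I S (\<pi> \<circ> \<rho>) m = c" "stop_pos I S (\<pi> \<circ> \<rho>) m = x"
    unfolding m_def schedules_def by auto
  define S' where "S' = S\<lparr>rdv_time := (rdv_time S)(\<pi> k := t), rdv_pos := (rdv_pos S)(\<pi> k := y)\<rparr>"
  define \<rho>' where "\<rho>' = \<rho>(Suc m := k)"
  have neq: "\<pi> k' \<noteq> \<pi> k" if "k' \<in> A" for k'
  proof
    assume "\<pi> k' = \<pi> k"
    then have "k' = k"
      using that A served_insert.hyps(2)
      by (intro inj_onD[OF bij_betw_imp_inj_on[OF bij]]) (auto simp: n_def)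
    then show False using that served_insert.hyps(2) by simp
  qed
  have \<rho>: "\<rho> i \<in> A" if "i \<in> {1..m}" for i
    using that bij_betwE[OF *(1)] by auto
  have old: "stop_time I S' (\<pi> \<circ> \<rho>') i = stop_time I S (\<pi> \<circ> \<rho>) i"
     "stop_pos I S' (\<pi> \<circ> \<rho>') i = stop_pos I S (\<pi> \<circ> \<rho>) i"
     "completion_time I S' (\<pi> \<circ> \<rho>') i = completion_time I S (\<pi> \<circ> \<rho>) i" if "i \<le> m" for i
    using that mn neq[OF \<rho>[of i]]
    by (auto simp: stop_time_def stop_pos_def completion_time_def S'_def \<rho>'_def n_def)
  have new: "stop_time I S' (\<pi> \<circ> \<rho>') (Suc m) = t" "stop_pos I S' (\<pi> \<circ> \<rho>') (Suc m) = y"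
     "completion_time I S' (\<pi> \<circ> \<rho>') (Suc m) = t + proc_time I (\<pi> k)"
    using mn by (auto simp: stop_time_def stop_pos_def completion_time_def S'_def \<rho>'_def n_def)
  have "bij_betw \<rho>' {1..m} A"
    using *(1) by (rule bij_betw_cong[THEN iffD1, rotated]) (auto simp: \<rho>'_def)
  then have "bij_betw \<rho>' ({1..m} \<union> {Suc m}) (A \<union> {\<rho>' (Suc m)})"
    using served_insert.hyps(2) by (intro notIn_Un_bij_betw) (auto simp: \<rho>'_def)
  then have bij': "bij_betw \<rho>' {1..Suc m} (insert k A)"
    by (simp add: \<rho>'_def atLeastAtMostSuc_conv insert_commute)
  show ?case
    unfolding card schedules_def
  proof (intro exI[of _ S'] exI[of _ \<rho>'] conjI ballI bij' new)
    fix i assume "i \<in> {1..Suc m}"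
    then consider "i \<in> {1..m}" | "i = Suc m" by fastforce
    then show "completion_time I S' (\<pi> \<circ> \<rho>') (i - 1) + \<bar>stop_pos I S' (\<pi> \<circ> \<rho>') i -
       stop_pos I S' (\<pi> \<circ> \<rho>') (i - 1)\<bar> \<le> stop_time I S' (\<pi> \<circ> \<rho>') i"
    proof cases
      case 1
      then have "i - 1 \<le> m" "i \<le> m" by auto
      then show ?thesis using *(2)[OF 1] by (simp add: old)
    next
      case 2
      then show ?thesis using *(4,5) served_insert.hyps by (simp add: old new)
    qed
  next
    fix k' assume "k' \<in> insert k A"
    then show "\<bar>rdv_pos S' (\<pi> k') - start I (\<pi> k')\<bar> \<le> speed I * rdv_time S' (\<pi> k')"
      using served_insert.hyps *(3) neq by (cases "k' = k") (auto simp: S'_def)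
  qed
qed

lemma served_feasible:
  assumes "served {1..num_clients I} c x"
  shows "\<exists>S. feasible I S \<and> makespan S = c + \<bar>x\<bar>"
proof -
  define n where "n = num_clients I"
  from served_schedules[OF assms] obtain S \<rho> where "schedules S \<rho> {1..n} c x"
    unfolding n_def by blast
  then have *: "bij_betw \<rho> {1..n} {1..n}"
    "\<And>i. i \<in> {1..n} \<Longrightarrow> completion_time I S (\<pi> \<circ> \<rho>) (i - 1) +
       \<bar>stop_pos I S (\<pi> \<circ> \<rho>) i - stop_pos I S (\<pi> \<circ> \<rho>) (i - 1)\<bar> \<le> stop_time I S (\<pi> \<circ> \<rho>) i"
    "\<And>k. k \<in> {1..n} \<Longrightarrow> \<bar>rdv_pos S (\<pi> k) - start I (\<pi> k)\<bar> \<le> speed I * rdv_time S (\<pi> k)"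
    "completion_time I S (\<pi> \<circ> \<rho>) n = c" "stop_pos I S (\<pi> \<circ> \<rho>) n = x"
    unfolding schedules_def by auto
  define S' where "S' = S\<lparr>end_time := c + \<bar>x\<bar>, end_pos := 0\<rparr>"
  define \<sigma> where "\<sigma> = \<pi> \<circ> \<rho>"
  have \<sigma>: "bij_betw \<sigma> {1..n} (clients I)"
    using bij_betw_trans[OF *(1)] bij by (simp add: \<sigma>_def n_def)
  have old: "stop_time I S' \<sigma> i = stop_time I S \<sigma> i" "stop_pos I S' \<sigma> i = stop_pos I S \<sigma> i"
     "completion_time I S' \<sigma> i = completion_time I S \<sigma> i" if "i \<le> n" for i
    using that by (auto simp: stop_time_def stop_pos_def completion_time_def S'_def n_def)
  have last: "stop_time I S' \<sigma> (Suc n) = c + \<bar>x\<bar>" "stop_pos I S' \<sigma> (Suc n) = 0"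
    by (auto simp: stop_time_def stop_pos_def S'_def n_def)
  have clients: "\<bar>rdv_pos S a - start I a\<bar> \<le> speed I * rdv_time S a" if a: "a \<in> clients I" for a
  proof -
    have "a \<in> \<pi> ` {1..n}" using a bij by (simp add: bij_betw_def n_def)
    then show ?thesis using *(3) by auto
  qed
  have succ: "stop_time I S \<sigma> (i - 1) \<le> stop_time I S \<sigma> i" if i: "i \<in> {1..n}" for i
  proof -
    have "0 \<le> proc_time I (\<sigma> (i - 1))" if "1 \<le> i - 1"
      using that i bij_betwE[OF \<sigma>] inst(1) by (auto simp: cltsp_instance_def)
    then have "stop_time I S \<sigma> (i - 1) \<le> completion_time I S \<sigma> (i - 1)"
      by (auto simp: completion_time_def)
    then show ?thesis using *(2)[OF i] unfolding \<sigma>_def by linarith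
  qed
  have mono: "stop_time I S \<sigma> i \<le> stop_time I S \<sigma> j" if "i \<le> j" "j \<le> n" for i j
    using that
  proof (induction j rule: dec_induct)
    case (step j)
    then show ?case using succ[of "Suc j"] by simp
  qed simp
  have order: "rdv_order I S' \<sigma>"
    unfolding rdv_order_def n_def[symmetric]
  proof (intro conjI \<sigma> mono_onI)
    fix i j assume "i \<in> {1..n}" "j \<in> {1..n}" "i \<le> j"
    then show "rdv_time S' (\<sigma> i) \<le> rdv_time S' (\<sigma> j)"
      using mono[of i j] by (simp add: stop_time_def S'_def n_def)
  qed
  have "feasible I S'"
    unfolding feasible_def n_def[symmetric]
  proof (intro conjI exI[of _ \<sigma>] order ballI)
    show "end_pos S' = 0" by (simp add: S'_def)
  next
    fix i assume "i \<in> {1..n + 1}"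
    then consider "i \<in> {1..n}" | "i = Suc n" by fastforce
    then show "completion_time I S' \<sigma> (i - 1) + \<bar>stop_pos I S' \<sigma> i - stop_pos I S' \<sigma> (i - 1)\<bar>
        \<le> stop_time I S' \<sigma> i"
      using *(2)[of i] *(4,5) by cases (auto simp: old last \<sigma>_def[symmetric])
  next
    fix a assume a: "a \<in> clients I"
    have v: "0 < speed I" using inst by (auto simp: slow_clients_def)
    have eq: "rdv_time S' a = rdv_time S a" "rdv_pos S' a = rdv_pos S a" by (auto simp: S'_def)
    have "0 \<le> speed I * rdv_time S a" using clients[OF a] by linarith
    then show t: "0 \<le> rdv_time S' a" using v by (simp add: eq zero_le_mult_iff)
    have r: "release I a = 0" "deadline I a = \<infinity>"
      using a inst by (auto simp: no_time_constraints_def)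
    show "release I a + \<bar>rdv_pos S' a - start I a\<bar> / speed I \<le> rdv_time S' a"
      using clients[OF a] v by (simp add: r eq field_simps)
    show "release I a \<le> rdv_time S' a" "ereal (rdv_time S' a) \<le> deadline I a"
      using t r by auto
  qed
  then show ?thesis by (intro exI[of _ S']) (auto simp: S'_def makespan_def)
qed

lemma feasible_served:
  assumes "feasible I S"
  shows "\<exists>c x. served {1..num_clients I} c x \<and> c + \<bar>x\<bar> \<le> makespan S"
proof -
  define n where "n = num_clients I"
  from assms obtain \<sigma> where \<sigma>: "bij_betw \<sigma> {1..n} (clients I)"
    and step: "\<And>i. i \<in> {1..n + 1} \<Longrightarrow>
      completion_time I S \<sigma> (i - 1) + \<bar>stop_pos I S \<sigma> i - stop_pos I S \<sigma> (i - 1)\<bar>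
        \<le> stop_time I S \<sigma> i"
    and client: "\<And>a. a \<in> clients I \<Longrightarrow> release I a + \<bar>rdv_pos S a - start I a\<bar> / speed I \<le> rdv_time S a"
    and [simp]: "end_pos S = 0"
    unfolding feasible_def rdv_order_def n_def by auto
  define \<rho> where "\<rho> = the_inv_into {1..n} \<pi> \<circ> \<sigma>"
  have \<rho>: "bij_betw \<rho> {1..n} {1..n}"
    unfolding \<rho>_def using bij_betw_trans[OF \<sigma>] bij_betw_the_inv_into[OF bij] by (simp add: n_def)
  have \<pi>\<rho>: "\<pi> (\<rho> i) = \<sigma> i" if "i \<in> {1..n}" for i
    using that bij_betwE[OF \<sigma>] bij unfolding \<rho>_def n_def
    by (auto simp: bij_betw_def intro!: f_the_inv_into_f)
  have "served (\<rho> ` {1..m}) (completion_time I S \<sigma> m) (stop_pos I S \<sigma> m)" if "m \<le> n" for m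
    using that
  proof (induction m)
    case 0
    show ?case using served_empty by (simp add: completion_time_def stop_time_def stop_pos_def)
  next
    case (Suc m)
    then have m: "Suc m \<in> {1..n}" by simp
    define a where "a = \<sigma> (Suc m)"
    have a: "a \<in> clients I" using m bij_betwE[OF \<sigma>] by (simp add: a_def)
    have ra: "release I a = 0" "0 < speed I"
      using a inst by (auto simp: no_time_constraints_def slow_clients_def)
    have stop: "stop_time I S \<sigma> (Suc m) = rdv_time S a" "stop_pos I S \<sigma> (Suc m) = rdv_pos S a"
      "completion_time I S \<sigma> (Suc m) = rdv_time S a + proc_time I a"
      using Suc.prems by (auto simp: stop_time_def stop_pos_def completion_time_def a_def n_def)
    have "served (insert (\<rho> (Suc m)) (\<rho> ` {1..m}))
      (rdv_time S a + proc_time I (\<pi> (\<rho> (Suc m)))) (rdv_pos S a)"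
    proof (rule served_insert)
      show "served (\<rho> ` {1..m}) (completion_time I S \<sigma> m) (stop_pos I S \<sigma> m)"
        using Suc by simp
      have "\<rho> (Suc m) \<notin> \<rho> ` {1..m}"
        using m inj_on_image_mem_iff[OF bij_betw_imp_inj_on[OF \<rho>], of "Suc m" "{1..m}"] by auto
      then show "\<rho> (Suc m) \<in> {1..num_clients I} - \<rho> ` {1..m}"
        using bij_betwE[OF \<rho>] m by (auto simp: n_def)
      show "completion_time I S \<sigma> m + \<bar>rdv_pos S a - stop_pos I S \<sigma> m\<bar> \<le> rdv_time S a"
        using step[of "Suc m"] m by (simp add: stop)
      show "\<bar>rdv_pos S a - start I (\<pi> (\<rho> (Suc m)))\<bar> \<le> speed I * rdv_time S a"
        using client[OF a] ra by (simp add: \<pi>\<rho>[OF m] a_def[symmetric] field_simps)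
    qed
    then show ?case
      by (simp add: stop \<pi>\<rho>[OF m] a_def[symmetric] atLeastAtMostSuc_conv)
  qed
  from this[of n] have "served {1..n} (completion_time I S \<sigma> n) (stop_pos I S \<sigma> n)"
    using \<rho> by (simp add: bij_betw_def)
  moreover have "stop_pos I S \<sigma> (n + 1) = 0" "stop_time I S \<sigma> (n + 1) = makespan S"
    by (simp_all add: stop_pos_def stop_time_def makespan_def n_def)
  then have "completion_time I S \<sigma> n + \<bar>stop_pos I S \<sigma> n\<bar> \<le> makespan S"
    using step[of "n + 1"] by simp
  ultimately show ?thesis unfolding n_def by blast
qed

end

section \<open>Running times of programs\<close>

fun loop_free :: "com \<Rightarrow> bool" where
  "loop_free (Seq c d) \<longleftrightarrow> loop_free c \<and> loop_free d"
| "loop_free (Cond b c d) \<longleftrightarrow> loop_free c \<and> loop_free d"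
| "loop_free (While b c) \<longleftrightarrow> False"
| "loop_free _ \<longleftrightarrow> True"

fun sem :: "com \<Rightarrow> mem \<Rightarrow> mem" where
  "sem (NStore a e) m = m\<lparr>nmem := (nmem m)(nval a m := nval e m)\<rparr>"
| "sem (RStore a e) m = m\<lparr>rmem := (rmem m)(nval a m := rval e m)\<rparr>"
| "sem (Seq c d) m = sem d (sem c m)"
| "sem (Cond b c d) m = (if bval b m then sem c m else sem d m)"
| "sem _ m = m"

fun cost :: "com \<Rightarrow> nat" where
  "cost (NStore a e) = 1 + ncost a + ncost e"
| "cost (RStore a e) = 1 + ncost a + rcost e"
| "cost (Seq c d) = cost c + cost d"
| "cost (Cond b c d) = 1 + bcost b + max (cost c) (cost d)"
| "cost _ = 1"

definition runs :: "com \<Rightarrow> mem \<Rightarrow> nat \<Rightarrow> (mem \<Rightarrow> bool) \<Rightarrow> bool" where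
  "runs c m b Q \<longleftrightarrow> (\<exists>k m'. exec c m k m' \<and> k \<le> b \<and> Q m')"

lemma exec_sem: "loop_free c \<Longrightarrow> \<exists>k\<le>cost c. exec c m k (sem c m)"
proof (induction c arbitrary: m)
  case Skip
  then show ?case using exec_Skip by auto
next
  case (NStore a e)
  then show ?case using exec_NStore by (intro exI[of _ "cost (NStore a e)"]) auto
next
  case (RStore a e)
  then show ?case using exec_RStore by (intro exI[of _ "cost (RStore a e)"]) auto
next
  case (Seq c d)
  from Seq.IH(1)[of m] Seq.prems obtain k where "k \<le> cost c" "exec c m k (sem c m)" by auto
  moreover from Seq.IH(2)[of "sem c m"] Seq.prems obtain l
    where "l \<le> cost d" "exec d (sem c m) l (sem d (sem c m))" by auto
  ultimately show ?case using exec_Seq by (intro exI[of _ "k + l"]) auto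
next
  case (Cond b c d)
  show ?case
  proof (cases "bval b m")
    case True
    from Cond.IH(1)[of m] Cond.prems obtain k where "k \<le> cost c" "exec c m k (sem c m)" by auto
    then show ?thesis using True exec_CondTrue by (intro exI[of _ "1 + bcost b + k"]) auto
  next
    case False
    from Cond.IH(2)[of m] Cond.prems obtain k where "k \<le> cost d" "exec d m k (sem d m)" by auto
    then show ?thesis using False exec_CondFalse by (intro exI[of _ "1 + bcost b + k"]) auto
  qed
qed simp

lemma runs_mono: "runs c m b Q \<Longrightarrow> b \<le> b' \<Longrightarrow> (\<And>m'. Q m' \<Longrightarrow> Q' m') \<Longrightarrow> runs c m b' Q'"
  unfolding runs_def by (meson le_trans)

lemma runs_sem: "loop_free c \<Longrightarrow> Q (sem c m) \<Longrightarrow> runs c m (cost c) Q"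
  using exec_sem[of c m] unfolding runs_def by blast

lemma runs_Seq: "runs c m a (\<lambda>m'. runs d m' b Q) \<Longrightarrow> runs (Seq c d) m (a + b) Q"
  unfolding runs_def using exec_Seq by (meson add_mono)

lemma runs_Cond:
  assumes "bval b m \<Longrightarrow> runs c m B Q" "\<not> bval b m \<Longrightarrow> runs d m B Q"
  shows "runs (Cond b c d) m (1 + bcost b + B) Q"
  using assms unfolding runs_def
  by (cases "bval b m") (meson exec_CondTrue exec_CondFalse add_le_cancel_left)+

lemma runs_While:
  assumes "J m"
    and body: "\<And>m. J m \<Longrightarrow> bval b m \<Longrightarrow> runs c m B (\<lambda>m'. J m' \<and> \<mu> m' < (\<mu> m :: nat))"
    and exit: "\<And>m. J m \<Longrightarrow> \<not> bval b m \<Longrightarrow> Q m"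
  shows "runs (While b c) m ((\<mu> m + 1) * (1 + bcost b + B)) Q"
  using assms(1)
proof (induction "\<mu> m" arbitrary: m rule: less_induct)
  case less
  show ?case
  proof (cases "bval b m")
    case True
    from body[OF less.prems True] obtain k m' where *: "exec c m k m'" "k \<le> B" "J m'" "\<mu> m' < \<mu> m"
      unfolding runs_def by auto
    from less.hyps[OF *(4,3)] obtain l m'' where
      **: "exec (While b c) m' l m''" "l \<le> (\<mu> m' + 1) * (1 + bcost b + B)" "Q m''"
      unfolding runs_def by auto
    have "l \<le> \<mu> m * (1 + bcost b + B)"
      using **(2) mult_le_mono1[of "\<mu> m' + 1" "\<mu> m" "1 + bcost b + B"] *(4) by linarith
    then have "1 + bcost b + k + l \<le> (\<mu> m + 1) * (1 + bcost b + B)"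
      using *(2) by (simp add: add_mult_distrib)
    then show ?thesis
      unfolding runs_def using exec_WhileTrue[OF True *(1) **(1)] **(3) by blast
  next
    case False
    then show ?thesis
      unfolding runs_def using exec_WhileFalse[OF False, of c] exit[OF less.prems False]
      by (intro exI[of _ "1 + bcost b"] exI[of _ m]) auto
  qed
qed

text \<open>
  Natural cell 1 holds \<open>n - i\<close> rather than \<open>i\<close>, which makes table addresses increase along transitions.
  Natural cells 4 to 6 belong to the loop over all table entries. Above the input, the real cells
  hold the position, the time, the best makespan, and the interleaved tables \<open>L\<close> and \<open>R\<close>.
\<close>

abbreviation "cell k \<equiv> NMem (NConst k)"
abbreviation "cN \<equiv> cell 0"
abbreviation "cl \<equiv> cell 1"
abbreviation "cj \<equiv> cell 2"
abbreviation "cp \<equiv> cell 3"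
abbreviation "ca \<equiv> cell 4"
abbreviation "cb \<equiv> cell 5"
abbreviation "cq \<equiv> cell 6"
abbreviation "scratch e \<equiv> NAdd (NAdd cN cN) e"
abbreviation "ax \<equiv> scratch (NConst 1)"
abbreviation "ac \<equiv> scratch (NConst 2)"
abbreviation "abest \<equiv> scratch (NConst 3)"
abbreviation "aL e \<equiv> scratch (NAdd (NConst 4) (NAdd e e))"
abbreviation "aR e \<equiv> scratch (NAdd (NConst 5) (NAdd e e))"
abbreviation "ci \<equiv> NSub cN cl"
abbreviation "width \<equiv> NAdd cN (NConst 2)"
abbreviation "rv \<equiv> RMem (NConst 0)"
abbreviation "rx \<equiv> RMem ax"
abbreviation "rc \<equiv> RMem ac"
abbreviation "rs e \<equiv> RMem e"
abbreviation "rtau e \<equiv> RMem (NAdd cN e)"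

definition relax :: "nexp \<Rightarrow> rexp \<Rightarrow> com" where
  "relax a e = Cond (BAnd (RLess (RConst 0) (RMem a)) (BNot (RLess e (RMem a)))) Skip (RStore a e)"

definition improve :: "real \<Rightarrow> real \<Rightarrow> real" where
  "improve old new = (if 0 < old \<and> old \<le> new then old else new)"

lemma improve_le: "0 < new \<Longrightarrow> 0 < improve old new \<and> improve old new \<le> new"
  "0 < old \<Longrightarrow> 0 < new \<Longrightarrow> 0 < improve old new \<and> improve old new \<le> old"
  by (auto simp: improve_def)

lemma sem_relax [simp]:
  "sem (relax a e) m =
     m\<lparr>rmem := (rmem m)(nval a m := improve (rmem m (nval a m)) (rval e m))\<rparr>"
  by (auto simp: relax_def improve_def)

definition canL :: bexp where
  "canL = BAnd (NLess cl cN) (BNot (RLess (RMul rv rc) (RSub rx (rs ci))))"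
definition canR :: bexp where
  "canR = BAnd (NLess cj (NAdd cN (NConst 1))) (BNot (RLess (RMul rv rc) (RSub (rs cj) rx)))"

definition serveL :: com where
  "serveL = Seq (RStore ac (RAdd rc (rtau ci)))
     (Seq (NStore (NConst 1) (NAdd cl (NConst 1))) (NStore (NConst 3) (NAdd cp width)))"
definition serveR :: com where
  "serveR = Seq (RStore ac (RAdd rc (rtau cj)))
     (Seq (NStore (NConst 2) (NAdd cj (NConst 1))) (NStore (NConst 3) (NAdd cp (NConst 1))))"

definition saturate :: com where
  "saturate = While (BNot (BAnd (BNot canL) (BNot canR))) (Cond canL serveL serveR)"

definition relax_next :: com where
  "relax_next =
     Seq (Cond (NLess cl cN)
       (relax (aL (NAdd cp width)) (RAdd (RConst 1) (RAdd rc
          (RDiv (RSub (RSub rx (rs ci)) (RMul rv rc)) (RAdd (RConst 1) rv))))) Skip)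
     (Seq (Cond (NLess cj (NAdd cN (NConst 1)))
       (relax (aR (NAdd cp (NConst 1))) (RAdd (RConst 1) (RAdd rc
          (RDiv (RSub (RSub (rs cj) rx) (RMul rv rc)) (RAdd (RConst 1) rv))))) Skip)
     (Cond (BAnd (BNot (NLess cl cN)) (NLess cN cj))
       (Cond (RLess rx (RConst 0))
        (relax abest (RAdd (RConst 1) (RSub rc rx)))
        (relax abest (RAdd (RConst 1) (RAdd rc rx)))) Skip))"


definition tabL :: "nat \<Rightarrow> mem \<Rightarrow> nat \<Rightarrow> real" where
  "tabL n m p = rmem m (n + n + (4 + (p + p)))"
definition tabR :: "nat \<Rightarrow> mem \<Rightarrow> nat \<Rightarrow> real" where
  "tabR n m p = rmem m (n + n + (5 + (p + p)))"
definition best :: "nat \<Rightarrow> mem \<Rightarrow> real" where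
  "best n m = rmem m (n + n + 3)"

context line
begin

definition holds_input :: "mem \<Rightarrow> bool" where
  "holds_input m \<longleftrightarrow> nmem m 0 = n \<and> rmem m 0 = v \<and> (\<forall>k\<in>{1..n}. rmem m k = s k \<and> rmem m (n + k) = \<tau> k)"

definition loaded :: "mem \<Rightarrow> nat \<Rightarrow> nat \<Rightarrow> real \<Rightarrow> real \<Rightarrow> bool" where
  "loaded m i j c x \<longleftrightarrow> nmem m 1 = n - i \<and> nmem m 2 = j \<and> nmem m 3 = index i j \<and>
     rmem m (n + n + 2) = c \<and> rmem m (n + n + 1) = x"

lemma index_succ:
  assumes "i \<le> n"
  shows "0 < i \<Longrightarrow> index (i - Suc 0) j = index i j + (n + 2)" "index i (Suc j) = index i j + 1"
proof -
  assume "0 < i"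
  then have "n - (i - Suc 0) = Suc (n - i)" using assms by simp
  then show "index (i - Suc 0) j = index i j + (n + 2)" by (simp add: index_def)
qed (simp add: index_def)

lemma index_mono:
  assumes "i \<le> i0" "j0 \<le> j"
  shows "index i0 j0 \<le> index i j"
  using assms by (auto simp: index_def intro!: add_mono mult_le_mono1)

lemma index_inj:
  assumes "index i j = a * (n + 2) + b" "j \<le> n + 1" "b \<le> n + 1" "i \<le> n"
  shows "a \<le> n \<and> i = n - a \<and> j = b"
proof -
  have div: "(a * w + b) div w = a" "(a * w + b) mod w = b" if "b < w" for a b w :: nat
    using that by auto
  have "n - i = a" "j = b"
    using div[of j "n + 2" "n - i"] div[of b "n + 2" a] assms(1-3) unfolding index_def by auto
  then show ?thesis using assms(4) by auto
qed

lemma loadedD: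
  assumes "holds_input m" "loaded m i j c x"
  shows "nmem m 0 = n" "rmem m 0 = v" "nmem m (Suc 0) = n - i" "nmem m 2 = j" "nmem m 3 = index i j"
    "rmem m (Suc (Suc (n + n))) = c" "rmem m (Suc (n + n)) = x"
    "\<And>k. 1 \<le> k \<Longrightarrow> k \<le> n \<Longrightarrow> rmem m k = s k" "\<And>k. 1 \<le> k \<Longrightarrow> k \<le> n \<Longrightarrow> rmem m (n + k) = \<tau> k"
  using assms by (auto simp: holds_input_def loaded_def)

lemma serve_sem:
  assumes "holds_input m" "loaded m i j c x" "i \<le> n"
  shows "0 < i \<Longrightarrow> holds_input (sem serveL m) \<and> loaded (sem serveL m) (i - 1) j (c + \<tau> i) x"
    and "1 \<le> j \<Longrightarrow> j \<le> n \<Longrightarrow> holds_input (sem serveR m) \<and> loaded (sem serveR m) i (j + 1) (c + \<tau> j) x"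
    and "tabL n (sem serveL m) = tabL n m" "tabR n (sem serveL m) = tabR n m"
      "best n (sem serveL m) = best n m" "tabL n (sem serveR m) = tabL n m"
      "tabR n (sem serveR m) = tabR n m" "best n (sem serveR m) = best n m"
      "3 < k \<Longrightarrow> nmem (sem serveL m) k = nmem m k" "3 < k \<Longrightarrow> nmem (sem serveR m) k = nmem m k"
  using loadedD[OF assms(1,2)] assms(3)
  by (auto simp: holds_input_def loaded_def serveL_def serveR_def index_succ tabL_def tabR_def best_def)

lemma relax_next_sem:
  assumes "holds_input m" "loaded m i j c x" "i \<le> n" "1 \<le> j"
  defines "m' \<equiv> sem relax_next m"
  shows "holds_input m'" "nmem m' = nmem m"
    and "tabL n m' = (if 0 < i then (tabL n m)(index (i - 1) j :=
            improve (tabL n m (index (i - 1) j)) (1 + meetL i c x)) else tabL n m)"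
    and "tabR n m' = (if j \<le> n then (tabR n m)(index i (j + 1) :=
            improve (tabR n m (index i (j + 1))) (1 + meetR j c x)) else tabR n m)"
    and "best n m' = (if i = 0 \<and> n < j then improve (best n m) (1 + (c + \<bar>x\<bar>)) else best n m)"
proof -
  note m = loadedD[OF assms(1,2)]
  show "nmem m' = nmem m" by (auto simp: m'_def relax_next_def)
  have parity: "Suc (p + p) \<noteq> q + q" "q + q \<noteq> Suc (p + p)" "p + p = q + q \<longleftrightarrow> p = q"
    "2 * p \<noteq> 3 + 2 * q" "2 * p \<noteq> 3 + (2 * r + 2 * q)"
    for p q r :: nat by presburger+
  show "holds_input m'"
    using m assms(3,4) by (auto simp: holds_input_def m'_def relax_next_def)
  show "tabL n m' = (if 0 < i then (tabL n m)(index (i - 1) j :=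
            improve (tabL n m (index (i - 1) j)) (1 + meetL i c x)) else tabL n m)"
    using m(1-8) assms(3,4)
    by (auto simp: fun_eq_iff m'_def relax_next_def tabL_def index_succ parity meetL_def)
  show "tabR n m' = (if j \<le> n then (tabR n m)(index i (j + 1) :=
            improve (tabR n m (index i (j + 1))) (1 + meetR j c x)) else tabR n m)"
    using m assms(3,4)
    by (auto simp: fun_eq_iff m'_def relax_next_def tabR_def index_succ parity meetR_def)
  show "best n m' = (if i = 0 \<and> n < j then improve (best n m) (1 + (c + \<bar>x\<bar>)) else best n m)"
    using m assms(3,4)
    by (auto simp: m'_def relax_next_def best_def)
qed

end

section \<open>Processing one table entry\<close>

definition process_entry :: com where
  "process_entry = Seq saturate relax_next"

definition saturate_step_cost :: nat where
  "saturate_step_cost = 1 + bcost (BNot (BAnd (BNot canL) (BNot canR))) + cost (Cond canL serveL serveR)"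

context sorted_line
begin

definition reached :: "nat \<Rightarrow> nat \<Rightarrow> real \<Rightarrow> real \<Rightarrow> bool" where
  "reached i j c x \<longleftrightarrow> i < j \<and> j \<le> n + 1 \<and> served {i<..<j} c x \<and>
     (\<forall>k\<in>{1..i}. s k \<le> x) \<and> (\<forall>k\<in>{j..n}. x \<le> s k)"

definition soundL :: "(nat \<Rightarrow> real) \<Rightarrow> bool" where
  "soundL L \<longleftrightarrow> (\<forall>p. 0 < L p \<longrightarrow> (\<exists>i j. p = index i j \<and> i < n \<and> i + 1 < j \<and>
     reached i j (L p - 1 + \<tau> (i + 1)) (s (i + 1) + v * (L p - 1))))"

definition soundR :: "(nat \<Rightarrow> real) \<Rightarrow> bool" where
  "soundR R \<longleftrightarrow> (\<forall>p. 0 < R p \<longrightarrow> (\<exists>i j. p = index i j \<and> i \<le> n \<and> i + 1 < j \<and>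
     reached i j (R p - 1 + \<tau> (j - 1)) (s (j - 1) - v * (R p - 1))))"

definition sound_best :: "real \<Rightarrow> bool" where
  "sound_best b \<longleftrightarrow> (0 < b \<longrightarrow> (\<exists>c x. served {1..n} c x \<and> b = 1 + (c + \<bar>x\<bar>)))"

definition sound :: "mem \<Rightarrow> bool" where
  "sound m \<longleftrightarrow> holds_input m \<and> soundL (tabL n m) \<and> soundR (tabR n m) \<and> sound_best (best n m)"

definition tightens :: "real \<Rightarrow> real \<Rightarrow> bool" where
  "tightens x y \<longleftrightarrow> (0 < x \<longrightarrow> 0 < y \<and> y \<le> x)"

definition better :: "mem \<Rightarrow> mem \<Rightarrow> bool" where
  "better m m' \<longleftrightarrow> (\<forall>p. tightens (tabL n m p) (tabL n m' p) \<and> tightens (tabR n m p) (tabR n m' p)) \<and>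
     tightens (best n m) (best n m')"

lemma better_refl: "better m m"
  by (simp add: better_def tightens_def)

lemma better_trans: "better m m' \<Longrightarrow> better m' m'' \<Longrightarrow> better m m''"
  unfolding better_def tightens_def by (meson order_trans)

lemma covered_better:
  assumes "better m m'" "covered (tabL n m) (tabR n m) (best n m) i j c x"
  shows "covered (tabL n m') (tabR n m') (best n m') i j c x"
  using assms unfolding covered_def better_def tightens_def by (meson order_trans)

abbreviation "settled_in m \<equiv> settled (tabL n m) (tabR n m) (best n m)"

lemma settled_better: "better m m' \<Longrightarrow> settled_in m H t x i j \<Longrightarrow> settled_in m' H t x i j"
  unfolding settled_def using covered_better by blast

lemma reached_serveL:
  assumes "reached i j c x" "0 < i" "x - s i \<le> v * c"
  shows "reached (i - 1) j (c + \<tau> i) x"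
proof -
  have "s i \<le> x" using assms(1,2) by (auto simp: reached_def)
  then have "served (insert i {i<..<j}) (c + \<tau> i) x"
    using assms by (intro served_insert) (auto simp: reached_def)
  moreover have "insert i {i<..<j} = {i - 1<..<j}" using assms by (auto simp: reached_def)
  ultimately show ?thesis using assms by (auto simp: reached_def)
qed

lemma reached_serveR:
  assumes "reached i j c x" "j \<le> n" "s j - x \<le> v * c"
  shows "reached i (j + 1) (c + \<tau> j) x"
proof -
  have "x \<le> s j" using assms(1,2) by (auto simp: reached_def)
  then have "served (insert j {i<..<j}) (c + \<tau> j) x"
    using assms by (intro served_insert) (auto simp: reached_def)
  moreover have "insert j {i<..<j} = {i<..<j + 1}" using assms by (auto simp: reached_def)
  ultimately show ?thesis using assms by (auto simp: reached_def)
qed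

lemma meet_time:
  assumes "v * c < w - x" "0 \<le> c"
  shows "c \<le> c + (w - x - v * c) / (1 + v)"
    and "w - v * (c + (w - x - v * c) / (1 + v)) = x + (w - x - v * c) / (1 + v)"
    and "0 \<le> (w - x - v * c) / (1 + v)"
  using assms v by (auto simp: field_simps)

lemma reached_meetL:
  assumes "reached i j c x" "0 < i" "v * c < x - s i"
  defines "t \<equiv> meetL i c x"
  shows "reached (i - 1) j (t + \<tau> i) (s i + v * t)" "0 \<le> t"
proof -
  have c: "0 \<le> c" using assms(1) served_nonneg by (auto simp: reached_def)
  define y where "y = (x - s i - v * c) / (1 + v)"
  have "t = c + y" "0 \<le> y" "s i + v * t = x - y"
    using meet_time[of c "- s i" "- x"] assms(3) c
    unfolding y_def t_def meetL_def by auto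
  note y = this
  show "0 \<le> t" using y c by simp
  then have vt: "0 \<le> v * t" using v by simp
  have "served (insert i {i<..<j}) (t + \<tau> i) (s i + v * t)"
    using assms y vt by (intro served_insert) (auto simp: reached_def)
  moreover have "insert i {i<..<j} = {i - 1<..<j}" using assms by (auto simp: reached_def)
  moreover have "s k \<le> s i + v * t" if "k \<in> {1..i - 1}" for k
  proof -
    have "s k \<le> s i" using that assms by (intro sorted) (auto simp: reached_def)
    then show ?thesis using vt by simp
  qed
  moreover have "s i + v * t \<le> s k" if "k \<in> {j..n}" for k
    using that assms y by (auto simp: reached_def intro: order_trans[of _ x])
  ultimately show "reached (i - 1) j (t + \<tau> i) (s i + v * t)"
    using assms by (auto simp: reached_def)
qed

lemma reached_meetR:
  assumes "reached i j c x" "j \<le> n" "v * c < s j - x"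
  defines "t \<equiv> meetR j c x"
  shows "reached i (j + 1) (t + \<tau> j) (s j - v * t)" "0 \<le> t"
proof -
  have c: "0 \<le> c" using assms(1) served_nonneg by (auto simp: reached_def)
  define y where "y = (s j - x - v * c) / (1 + v)"
  have "t = c + y" "0 \<le> y" "s j - v * t = x + y"
    using meet_time[of c "s j" x] assms(3) c
    unfolding y_def t_def meetR_def by auto
  note y = this
  show "0 \<le> t" using y c by simp
  then have vt: "0 \<le> v * t" using v by simp
  have "served (insert j {i<..<j}) (t + \<tau> j) (s j - v * t)"
    using assms y vt by (intro served_insert) (auto simp: reached_def)
  moreover have "insert j {i<..<j} = {i<..<j + 1}" using assms by (auto simp: reached_def)
  moreover have "s j - v * t \<le> s k" if "k \<in> {j + 1..n}" for k
    using sorted[of j k] that vt assms by (auto simp: reached_def)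
  moreover have "s k \<le> s j - v * t" if "k \<in> {1..i}" for k
    using that assms y by (auto simp: reached_def intro: order_trans[of _ x])
  ultimately show "reached i (j + 1) (t + \<tau> j) (s j - v * t)"
    using assms by (auto simp: reached_def)
qed

definition saturating :: "mem \<Rightarrow> nat set \<Rightarrow> real \<Rightarrow> real \<Rightarrow> nat \<Rightarrow> nat \<Rightarrow> nat \<Rightarrow> nat \<Rightarrow> real \<Rightarrow> mem \<Rightarrow> bool" where
  "saturating m0 H t x i0 j0 i j c m \<longleftrightarrow>
     holds_input m \<and> loaded m i j c x \<and> reached i j c x \<and> i \<le> i0 \<and> j0 \<le> j \<and>
     c = t + sum \<tau> ({i<..<j} - H) \<and>
     tabL n m = tabL n m0 \<and> tabR n m = tabR n m0 \<and> best n m = best n m0 \<and>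
     (\<forall>k>3. nmem m k = nmem m0 k)"

lemma bval_can:
  assumes "holds_input m" "loaded m i j c x" "i \<le> n" "1 \<le> j"
  shows "bval canL m \<longleftrightarrow> 0 < i \<and> x - s i \<le> v * c" "bval canR m \<longleftrightarrow> j \<le> n \<and> s j - x \<le> v * c"
  using loadedD[OF assms(1,2)] assms(3,4) by (auto simp: canL_def canR_def not_less)

lemma runs_saturate:
  assumes m0: "holds_input m0" "loaded m0 i0 j0 c0 x" "reached i0 j0 c0 x" "i0 \<le> n"
    and c0: "c0 = t + sum \<tau> ({i0<..<j0} - H)" "H \<subseteq> {i0<..<j0}"
  shows "runs saturate m0 ((2 * n + 2) * saturate_step_cost)
     (\<lambda>m. \<exists>i j c. saturating m0 H t x i0 j0 i j c m \<and> stuck i j c x)"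
proof -
  define J where "J m \<longleftrightarrow> (\<exists>i j c. saturating m0 H t x i0 j0 i j c m)" for m
  define \<mu> where "\<mu> m = (n - nmem m 1) + (n + 1 - nmem m 2)" for m :: mem
  have J0: "J m0" using assms unfolding J_def saturating_def by blast
  have exit: "\<exists>i j c. saturating m0 H t x i0 j0 i j c m \<and> stuck i j c x"
    if "J m" "\<not> bval (BNot (BAnd (BNot canL) (BNot canR))) m" for m
  proof -
    from that(1) obtain i j c where S: "saturating m0 H t x i0 j0 i j c m" unfolding J_def by auto
    then have m: "holds_input m" "loaded m i j c x" "i \<le> n" "1 \<le> j"
      using m0(4) by (auto simp: saturating_def reached_def)
    show ?thesis using S that(2) bval_can[OF m] by (intro exI[of _ i] exI[of _ j] exI[of _ c]) (auto simp: stuck_def)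
  qed
  have body: "runs (Cond canL serveL serveR) m (cost (Cond canL serveL serveR)) (\<lambda>m'. J m' \<and> \<mu> m' < \<mu> m)"
    if "J m" "bval (BNot (BAnd (BNot canL) (BNot canR))) m" for m
  proof (rule runs_sem)
    show "loop_free (Cond canL serveL serveR)" by (simp add: serveL_def serveR_def)
    from that(1) obtain i j c where S: "saturating m0 H t x i0 j0 i j c m" unfolding J_def by auto
    then have m: "holds_input m" "loaded m i j c x" "i \<le> n" "1 \<le> j"
      and ij: "i < j" "j \<le> n + 1" "i \<le> i0" "j0 \<le> j" and cf: "reached i j c x"
      and c: "c = t + sum \<tau> ({i<..<j} - H)"
      using m0(4) by (auto simp: saturating_def reached_def)
    note can = bval_can[OF m] and sv = serve_sem[OF m(1-3)]
    show "J (sem (Cond canL serveL serveR) m) \<and> \<mu> (sem (Cond canL serveL serveR) m) < \<mu> m"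
    proof (cases "bval canL m")
      case True
      then have i: "0 < i" "x - s i \<le> v * c" using can by auto
      have eq: "{i - 1<..<j} - H = insert i ({i<..<j} - H)" using i ij c0(2) by auto
      have "saturating m0 H t x i0 j0 (i - 1) j (c + \<tau> i) (sem serveL m)"
        using S sv reached_serveL[OF cf i] i c ij unfolding saturating_def eq by auto
      moreover from this have "\<mu> (sem serveL m) < \<mu> m"
        using m i ij by (auto simp: \<mu>_def loaded_def saturating_def)
      ultimately show ?thesis using True unfolding J_def by auto
    next
      case False
      then have j: "j \<le> n" "s j - x \<le> v * c" using can that(2) by auto
      have eq: "{i<..<j + 1} - H = insert j ({i<..<j} - H)" using j ij c0(2) by auto
      have "saturating m0 H t x i0 j0 i (j + 1) (c + \<tau> j) (sem serveR m)"
        using S sv reached_serveR[OF cf j] j c ij m unfolding saturating_def eq by auto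
      moreover from this have "\<mu> (sem serveR m) < \<mu> m"
        using m j ij by (auto simp: \<mu>_def loaded_def saturating_def)
      ultimately show ?thesis using False unfolding J_def by auto
    qed
  qed
  have "\<mu> m0 + 1 \<le> 2 * n + 2" by (auto simp: \<mu>_def)
  then show ?thesis
    unfolding saturate_def
    by (intro runs_mono[OF runs_While[where J = J and \<mu> = \<mu>, OF J0 body exit]])
      (auto simp only: saturate_step_cost_def intro!: mult_le_mono1)
qed

lemma relax_next_spec:
  assumes m: "sound m" "loaded m i j c x" "reached i j c x" "i \<le> n" "stuck i j c x"
  defines "m' \<equiv> sem relax_next m"
  shows "sound m'" "better m m'" "covered (tabL n m') (tabR n m') (best n m') i j c x"
    "\<And>p. p \<le> index i j \<Longrightarrow> tabL n m' p = tabL n m p \<and> tabR n m' p = tabR n m p"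
    "nmem m' = nmem m"
proof -
  have j: "1 \<le> j" "i < j" "j \<le> n + 1" using m(3) by (auto simp: reached_def)
  have holds_input: "holds_input m" using m(1) by (simp add: sound_def)
  note sem = relax_next_sem[OF holds_input m(2,4) j(1), folded m'_def]
  have tL: "reached (i - 1) j (meetL i c x + \<tau> i) (s i + v * meetL i c x)" "0 \<le> meetL i c x" if "0 < i"
    using reached_meetL[OF m(3) that] m(5) that by (auto simp: stuck_def)
  have tR: "reached i (j + 1) (meetR j c x + \<tau> j) (s j - v * meetR j c x)" "0 \<le> meetR j c x" if "j \<le> n"
    using reached_meetR[OF m(3) that] m(5) that by (auto simp: stuck_def)
  have c: "0 \<le> c" using m(3) served_nonneg by (auto simp: reached_def)
  have index: "index i j < index (i - 1) j" if "0 < i"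
    using index_succ(1)[OF m(4) that] by simp
  have index': "index i j < index i (j + 1)" using index_succ(2)[OF m(4)] by simp
  show "nmem m' = nmem m" by (rule sem)
  show "\<And>p. p \<le> index i j \<Longrightarrow> tabL n m' p = tabL n m p \<and> tabR n m' p = tabR n m p"
    using index index' by (auto simp: sem(3,4))
  show "better m m'"
    using tL(2) tR(2) c improve_le(2) by (auto simp: better_def tightens_def sem(3-5))
  show "covered (tabL n m') (tabR n m') (best n m') i j c x"
    using tL(2) tR(2) c improve_le(1) by (auto simp: covered_def sem(3-5))
  have "soundL (tabL n m')"
    unfolding soundL_def
  proof (intro allI impI)
    fix p assume p: "0 < tabL n m' p"
    show "\<exists>i j. p = index i j \<and> i < n \<and> i + 1 < j \<and> reached i j (tabL n m' p - 1 + \<tau> (i + 1))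
        (s (i + 1) + v * (tabL n m' p - 1))"
    proof (cases "tabL n m' p = tabL n m p")
      case True
      then show ?thesis using m(1) p by (auto simp: sound_def soundL_def)
    next
      case False
      then have "0 < i" "p = index (i - 1) j" "tabL n m' p = 1 + meetL i c x"
        by (auto simp: sem(3) improve_def split: if_splits)
      then show ?thesis using tL m(4) j by (intro exI[of _ "i - 1"] exI[of _ j]) auto
    qed
  qed
  moreover have "soundR (tabR n m')"
    unfolding soundR_def
  proof (intro allI impI)
    fix p assume p: "0 < tabR n m' p"
    show "\<exists>i j. p = index i j \<and> i \<le> n \<and> i + 1 < j \<and> reached i j (tabR n m' p - 1 + \<tau> (j - 1))
        (s (j - 1) - v * (tabR n m' p - 1))"
    proof (cases "tabR n m' p = tabR n m p")
      case True
      then show ?thesis using m(1) p by (auto simp: sound_def soundR_def)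
    next
      case False
      then have "j \<le> n" "p = index i (j + 1)" "tabR n m' p = 1 + meetR j c x"
        by (auto simp: sem(4) improve_def split: if_splits)
      then show ?thesis using tR m(4) j by (intro exI[of _ i] exI[of _ "j + 1"]) auto
    qed
  qed
  moreover have "sound_best (best n m')"
  proof (cases "best n m' = best n m")
    case True
    then show ?thesis using m(1) by (simp add: sound_def)
  next
    case False
    then have "i = 0" "j = n + 1" "best n m' = 1 + (c + \<bar>x\<bar>)"
      using j by (auto simp: sem(5) improve_def split: if_splits)
    moreover have "{0<..<n + 1} = {1..n}" by auto
    ultimately show ?thesis using m(3) by (auto simp: sound_best_def reached_def)
  qed
  ultimately show "sound m'" using sem(1) by (simp add: sound_def)
qed

lemma runs_process_entry:
  assumes m: "sound m" "loaded m i j c0 x" "reached i j c0 x" "i \<le> n"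
    and c0: "c0 = t + sum \<tau> ({i<..<j} - H)" "H \<subseteq> {i<..<j}"
  shows "runs process_entry m ((2 * n + 2) * saturate_step_cost + cost relax_next)
    (\<lambda>m'. sound m' \<and> better m m' \<and> settled_in m' H t x i j \<and>
      (\<forall>p\<le>index i j. tabL n m' p = tabL n m p \<and> tabR n m' p = tabR n m p) \<and>
      (\<forall>k>3. nmem m' k = nmem m k))"
  unfolding process_entry_def
proof (rule runs_Seq, rule runs_mono[OF runs_saturate order_refl])
  show "holds_input m" using m(1) by (simp add: sound_def)
  fix m1 assume "\<exists>i' j' c. saturating m H t x i j i' j' c m1 \<and> stuck i' j' c x"
  then obtain i' j' c where S: "saturating m H t x i j i' j' c m1" and stuck: "stuck i' j' c x"
    by auto
  then have ij: "i' \<le> i" "j \<le> j'" "i' < j'" "j' \<le> n + 1" and c: "c = t + sum \<tau> ({i'<..<j'} - H)"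
    and tabs: "tabL n m1 = tabL n m" "tabR n m1 = tabR n m" "best n m1 = best n m"
    and other: "\<forall>k>3. nmem m1 k = nmem m k"
    and m1: "loaded m1 i' j' c x" "reached i' j' c x"
    by (auto simp: saturating_def reached_def)
  have sound1: "sound m1" using S m(1) tabs by (auto simp: sound_def saturating_def)
  have i'n: "i' \<le> n" using ij m(4) by simp
  note post = relax_next_spec[OF sound1 m1 i'n stuck]
  have le: "index i j \<le> index i' j'" using ij by (intro index_mono) auto
  show "runs relax_next m1 (cost relax_next)
    (\<lambda>m'. sound m' \<and> better m m' \<and> settled_in m' H t x i j \<and>
      (\<forall>p\<le>index i j. tabL n m' p = tabL n m p \<and> tabR n m' p = tabR n m p) \<and>
      (\<forall>k>3. nmem m' k = nmem m k))"
  proof (rule runs_sem, goal_cases)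
    case 1
    then show ?case by (simp add: relax_next_def relax_def)
  next
    case 2
    have "better m (sem relax_next m1)" using post(2) tabs by (simp add: better_def)
    moreover have "settled_in (sem relax_next m1) H t x i j"
      unfolding settled_def using ij c stuck post(3) by blast
    ultimately show ?case
      using post(1,4,5) le tabs other by auto
  qed
qed (use assms in auto)

end

section \<open>Sweeping the table\<close>

definition loadL :: com where
  "loadL = Seq (NStore (NConst 1) ca) (Seq (NStore (NConst 2) cb) (Seq (NStore (NConst 3) cq)
     (Seq (RStore ax (RAdd (rs (NAdd ci (NConst 1))) (RMul rv (RSub (RMem (aL cq)) (RConst 1)))))
       (RStore ac (RAdd (RSub (RMem (aL cq)) (RConst 1)) (rtau (NAdd ci (NConst 1))))))))"

definition loadR :: com where
  "loadR = Seq (NStore (NConst 1) ca) (Seq (NStore (NConst 2) cb) (Seq (NStore (NConst 3) cq)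
     (Seq (RStore ax (RSub (rs (NSub cj (NConst 1))) (RMul rv (RSub (RMem (aR cq)) (RConst 1)))))
       (RStore ac (RAdd (RSub (RMem (aR cq)) (RConst 1)) (rtau (NSub cj (NConst 1))))))))"

definition slotL :: com where
  "slotL = Cond (RLess (RConst 0) (RMem (aL cq))) (Seq loadL process_entry) Skip"
definition slotR :: com where
  "slotR = Cond (RLess (RConst 0) (RMem (aR cq))) (Seq loadR process_entry) Skip"
definition advance :: com where
  "advance = Seq (NStore (NConst 5) (NAdd cb (NConst 1))) (Seq (NStore (NConst 6) (NAdd cq (NConst 1)))
     (Cond (NLess cb width) Skip
       (Seq (NStore (NConst 5) (NConst 0)) (NStore (NConst 4) (NAdd ca (NConst 1))))))"
definition sweep :: com where
  "sweep = While (NLess ca (NAdd cN (NConst 1))) (Seq slotL (Seq slotR advance))"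

definition find_origin :: com where
  "find_origin = Seq (NStore (NConst 1) (NConst 0)) (Seq (NStore (NConst 3) (NConst 0))
     (Seq (While (BAnd (NLess cl cN) (BNot (RLess (rs ci) (RConst 0))))
       (Seq (NStore (NConst 1) (NAdd cl (NConst 1))) (NStore (NConst 3) (NAdd cp width))))
     (Seq (NStore (NConst 2) (NAdd ci (NConst 1))) (Seq (NStore (NConst 3) (NAdd cp cj))
     (Seq (RStore ax (RConst 0)) (RStore ac (RConst 0)))))))"

definition start_sweep :: com where
  "start_sweep = Seq (NStore (NConst 4) (NConst 0)) (Seq (NStore (NConst 5) (NConst 0)) (NStore (NConst 6) (NConst 0)))"

definition solve :: com where
  "solve = Seq find_origin (Seq process_entry (Seq start_sweep (Seq sweep
     (RStore (NConst 0) (RSub (RMem abest) (RConst 1))))))"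

definition process_cost :: "nat \<Rightarrow> nat" where
  "process_cost n = (2 * n + 2) * saturate_step_cost + cost relax_next"

definition slot_cost :: "nat \<Rightarrow> nat" where
  "slot_cost n = 1 + bcost (RLess (RConst 0) (RMem (aL cq))) + (cost loadL + process_cost n)"

definition find_cost :: "nat \<Rightarrow> nat" where
  "find_cost n = 100 + (n + 1) * 100"

definition sweep_cost :: "nat \<Rightarrow> nat" where
  "sweep_cost n = ((n + 1) * (n + 2) + 1) *
     (1 + bcost (NLess ca (NAdd cN (NConst 1))) + (slot_cost n + (slot_cost n + cost advance)))"

definition solve_cost :: "nat \<Rightarrow> nat" where
  "solve_cost n = find_cost n + (process_cost n + (cost start_sweep + (sweep_cost n + 100)))"

context sorted_line
begin

abbreviation "agree q m m' \<equiv>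
  (\<forall>p\<le>q. tabL n m' p = tabL n m p \<and> tabR n m' p = tabR n m p) \<and> (\<forall>k>3. nmem m' k = nmem m k)"

definition processedL :: "mem \<Rightarrow> nat \<Rightarrow> nat \<Rightarrow> bool" where
  "processedL m i j \<longleftrightarrow> (0 < tabL n m (index i j) \<longrightarrow>
     settled_in m {i + 1<..<j} (tabL n m (index i j) - 1) (s (i + 1) + v * (tabL n m (index i j) - 1)) i j)"

definition processedR :: "mem \<Rightarrow> nat \<Rightarrow> nat \<Rightarrow> bool" where
  "processedR m i j \<longleftrightarrow> (0 < tabR n m (index i j) \<longrightarrow>
     settled_in m {i<..<j - 1} (tabR n m (index i j) - 1) (s (j - 1) - v * (tabR n m (index i j) - 1)) i j)"

lemma processed_split:
  "processed (tabL n m) (tabR n m) (best n m) i j \<longleftrightarrow> processedL m i j \<and> processedR m i j"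
  by (simp add: processed_def processedL_def processedR_def)

lemma processed_persists:
  assumes "better m m'" "agree q m m'" "index i j \<le> q"
  shows "processedL m i j \<Longrightarrow> processedL m' i j" "processedR m i j \<Longrightarrow> processedR m' i j"
  using assms settled_better[OF assms(1)] by (auto simp: processedL_def processedR_def)

lemma runs_slotL:
  assumes m: "sound m" "nmem m 4 = a" "nmem m 5 = b" "nmem m 6 = a * (n + 2) + b" "a \<le> n" "b \<le> n + 1"
  shows "runs slotL m (slot_cost n) (\<lambda>m'. sound m' \<and> better m m' \<and>
     agree (a * (n + 2) + b) m m' \<and> processedL m' (n - a) b)"
  unfolding slotL_def slot_cost_def
proof (rule runs_Cond)
  define q where "q = a * (n + 2) + b"
  have n: "nmem m 0 = n" using m(1) by (simp add: sound_def holds_input_def)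
  have cond: "bval (RLess (RConst 0) (RMem (aL cq))) m \<longleftrightarrow> 0 < tabL n m q"
    using m(4) n by (simp add: tabL_def q_def)
  {
    assume "bval (RLess (RConst 0) (RMem (aL cq))) m"
    then have pos: "0 < tabL n m q" using cond by simp
    define t where "t = tabL n m q - 1"
    from pos m(1) obtain i j where ij: "q = index i j" "i < n" "i + 1 < j"
      and reached: "reached i j (t + \<tau> (i + 1)) (s (i + 1) + v * t)"
      unfolding sound_def soundL_def t_def by blast
    have "j \<le> n + 1" using reached by (simp add: reached_def)
    with ij index_inj[of i j a b] m have ab: "i = n - a" "j = b" by (auto simp: q_def)
    define m1 where "m1 = sem loadL m"
    have holds_input: "rmem m k = s k" "rmem m (n + k) = \<tau> k" if "1 \<le> k" "k \<le> n" for k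
      using m(1) that by (auto simp: sound_def holds_input_def)
    have facts: "nmem m 0 = n" "nmem m 4 = a" "nmem m 5 = b" "nmem m 6 = q" "rmem m 0 = v"
      "rmem m (Suc i) = s (Suc i)" "rmem m (Suc (n + i)) = \<tau> (Suc i)"
      "rmem m (n + n + (4 + (q + q))) = t + 1" "n - a = i"
      using m(1-4) ij(2) ab n holds_input[of "Suc i"] by (simp_all add: q_def sound_def holds_input_def t_def tabL_def)
    have nm: "nmem m1 = (nmem m)(1 := a, 2 := b, 3 := q)"
      using facts by (simp add: m1_def loadL_def)
    have rm: "rmem m1 = (rmem m)(n + n + 1 := s (i + 1) + v * t, n + n + 2 := t + \<tau> (i + 1))"
      using facts ij(2) by (simp add: m1_def loadL_def)
    have tabs: "tabL n m1 = tabL n m" "tabR n m1 = tabR n m" "best n m1 = best n m"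
      by (auto simp: tabL_def tabR_def best_def rm)
    have "holds_input m1" using m(1) by (auto simp: sound_def holds_input_def nm rm)
    then have sound1: "sound m1" using m(1) by (simp add: sound_def tabs)
    have "n - i = a" using ij ab m by simp
    then have loaded1: "loaded m1 i j (t + \<tau> (i + 1)) (s (i + 1) + v * t)"
      using ab ij(1) by (simp add: loaded_def nm rm)
    have eq: "{i<..<j} - {i + 1<..<j} = {i + 1}" using ij by auto
    have c0: "t + \<tau> (i + 1) = t + sum \<tau> ({i<..<j} - {i + 1<..<j})" unfolding eq by simp
    have "runs process_entry m1 (process_cost n) (\<lambda>m'. sound m' \<and> better m1 m' \<and>
      settled_in m' {i + 1<..<j} t (s (i + 1) + v * t) i j \<and> agree (index i j) m1 m')"
      unfolding process_cost_def using ij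
      by (intro runs_process_entry[OF sound1 loaded1 reached _ c0]) auto
    then have "runs process_entry m1 (process_cost n)
      (\<lambda>m'. sound m' \<and> better m m' \<and> agree q m m' \<and> processedL m' (n - a) b)"
    proof (rule runs_mono[OF _ order_refl], goal_cases)
      case (1 m')
      then show ?case
        using tabs ij(1) ab by (auto simp: better_def nm processedL_def t_def q_def)
    qed
    then show "runs (Seq loadL process_entry) m (cost loadL + process_cost n)
      (\<lambda>m'. sound m' \<and> better m m' \<and> agree (a * (n + 2) + b) m m' \<and> processedL m' (n - a) b)"
      unfolding q_def m1_def
      by (intro runs_Seq runs_sem) (auto simp: loadL_def)
  }
  {
    assume neg: "\<not> bval (RLess (RConst 0) (RMem (aL cq))) m"
    have "index (n - a) b = q" using m by (simp add: index_def q_def)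
    then have "processedL m (n - a) b" using neg cond by (simp add: processedL_def)
    then have "runs Skip m (cost Skip)
      (\<lambda>m'. sound m' \<and> better m m' \<and> agree (a * (n + 2) + b) m m' \<and> processedL m' (n - a) b)"
      using m better_refl by (intro runs_sem) auto
    then show "runs Skip m (cost loadL + process_cost n)
      (\<lambda>m'. sound m' \<and> better m m' \<and> agree (a * (n + 2) + b) m m' \<and> processedL m' (n - a) b)"
      by (rule runs_mono) (auto simp: loadL_def)
  }
qed

lemma runs_slotR:
  assumes m: "sound m" "nmem m 4 = a" "nmem m 5 = b" "nmem m 6 = a * (n + 2) + b" "a \<le> n" "b \<le> n + 1"
  shows "runs slotR m (slot_cost n) (\<lambda>m'. sound m' \<and> better m m' \<and>
     agree (a * (n + 2) + b) m m' \<and> processedR m' (n - a) b)"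
proof -
  have cost: "1 + bcost (RLess (RConst 0) (RMem (aR cq))) + (cost loadR + process_cost n) \<le> slot_cost n"
    by (simp add: slot_cost_def loadL_def loadR_def)
  show ?thesis unfolding slotR_def
  proof (rule runs_mono[OF runs_Cond cost])
    define q where "q = a * (n + 2) + b"
    have n: "nmem m 0 = n" using m(1) by (simp add: sound_def holds_input_def)
    have cond: "bval (RLess (RConst 0) (RMem (aR cq))) m \<longleftrightarrow> 0 < tabR n m q"
      using m(4) n by (simp add: tabR_def q_def)
    {
      assume "bval (RLess (RConst 0) (RMem (aR cq))) m"
      then have pos: "0 < tabR n m q" using cond by simp
      define t where "t = tabR n m q - 1"
      from pos m(1) obtain i j where ij: "q = index i j" "i \<le> n" "i + 1 < j"
        and reached: "reached i j (t + \<tau> (j - 1)) (s (j - 1) - v * t)"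
        unfolding sound_def soundR_def t_def by blast
      have jn: "j \<le> n + 1" using reached by (simp add: reached_def)
      with ij index_inj[of i j a b] m have ab: "i = n - a" "j = b" by (auto simp: q_def)
      define m1 where "m1 = sem loadR m"
      have j1: "1 \<le> j - Suc 0" "j - Suc 0 \<le> n" using ij jn by auto
      have holds_input: "rmem m k = s k" "rmem m (n + k) = \<tau> k" if "1 \<le> k" "k \<le> n" for k
        using m(1) that by (auto simp: sound_def holds_input_def)
      have facts: "nmem m 0 = n" "nmem m 4 = a" "nmem m 5 = b" "nmem m 6 = q" "rmem m 0 = v"
        "rmem m (j - Suc 0) = s (j - Suc 0)" "rmem m (n + (j - Suc 0)) = \<tau> (j - Suc 0)"
        "rmem m (n + n + (5 + (q + q))) = t + 1" "b = j" "j \<noteq> n + n + 2"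
        using m(1-4) ij(3) ab(2) n jn holds_input[OF j1]
        by (simp_all add: q_def sound_def holds_input_def t_def tabR_def)
      have nm: "nmem m1 = (nmem m)(1 := a, 2 := b, 3 := q)"
        using facts by (simp add: m1_def loadR_def)
      have ne: "n + (j - Suc 0) \<noteq> Suc (n + n)" using jn ij by auto
      have rm: "rmem m1 = (rmem m)(n + n + 1 := s (j - 1) - v * t, n + n + 2 := t + \<tau> (j - 1))"
        using facts ne by (simp add: m1_def loadR_def)
      have tabs: "tabL n m1 = tabL n m" "tabR n m1 = tabR n m" "best n m1 = best n m"
        by (auto simp: tabL_def tabR_def best_def rm)
      have "holds_input m1" using m(1) by (auto simp: sound_def holds_input_def nm rm)
      then have sound1: "sound m1" using m(1) by (simp add: sound_def tabs)
      have "n - i = a" using ij ab m by simp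
      then have loaded1: "loaded m1 i j (t + \<tau> (j - 1)) (s (j - 1) - v * t)"
        using ab ij(1) by (simp add: loaded_def nm rm)
      have eq: "{i<..<j} - {i<..<j - 1} = {j - 1}" using ij by auto
      have c0: "t + \<tau> (j - 1) = t + sum \<tau> ({i<..<j} - {i<..<j - 1})" unfolding eq by simp
      have "runs process_entry m1 (process_cost n) (\<lambda>m'. sound m' \<and> better m1 m' \<and>
        settled_in m' {i<..<j - 1} t (s (j - 1) - v * t) i j \<and> agree (index i j) m1 m')"
        unfolding process_cost_def using ij
        by (intro runs_process_entry[OF sound1 loaded1 reached _ c0]) auto
      then have "runs process_entry m1 (process_cost n)
        (\<lambda>m'. sound m' \<and> better m m' \<and> agree q m m' \<and> processedR m' (n - a) b)"
      proof (rule runs_mono[OF _ order_refl], goal_cases)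
        case (1 m')
        then show ?case
          using tabs ij(1) ab by (auto simp: better_def nm processedR_def t_def q_def)
      qed
      then show "runs (Seq loadR process_entry) m (cost loadR + process_cost n)
        (\<lambda>m'. sound m' \<and> better m m' \<and> agree (a * (n + 2) + b) m m' \<and> processedR m' (n - a) b)"
        unfolding q_def m1_def
        by (intro runs_Seq runs_sem) (auto simp: loadR_def)
    }
    {
      assume neg: "\<not> bval (RLess (RConst 0) (RMem (aR cq))) m"
      have "index (n - a) b = q" using m by (simp add: index_def q_def)
      then have "processedR m (n - a) b" using neg cond by (simp add: processedR_def)
      then have "runs Skip m (cost Skip)
        (\<lambda>m'. sound m' \<and> better m m' \<and> agree (a * (n + 2) + b) m m' \<and> processedR m' (n - a) b)"
        using m better_refl by (intro runs_sem) auto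
      then show "runs Skip m (cost loadR + process_cost n)
        (\<lambda>m'. sound m' \<and> better m m' \<and> agree (a * (n + 2) + b) m m' \<and> processedR m' (n - a) b)"
        by (rule runs_mono) (auto simp: loadR_def)
    }
  qed
qed

definition sweeping :: "nat \<Rightarrow> nat \<Rightarrow> mem \<Rightarrow> bool" where
  "sweeping u w m \<longleftrightarrow> sound m \<and> settled_in m {} 0 0 u w \<and> nmem m 4 \<le> n + 1 \<and> nmem m 5 \<le> n + 1 \<and>
     nmem m 6 = nmem m 4 * (n + 2) + nmem m 5 \<and>
     (\<forall>i\<le>n. \<forall>j\<le>n + 1. index i j < nmem m 6 \<longrightarrow> processedL m i j \<and> processedR m i j)"

lemma advance_sem:
  assumes "nmem m 0 = n" "nmem m 4 = a" "nmem m 5 = b" "nmem m 6 = a * (n + 2) + b" "a \<le> n" "b \<le> n + 1"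
  defines "m' \<equiv> sem advance m"
  shows "rmem m' = rmem m" "nmem m' 0 = n" "nmem m' 4 \<le> n + 1" "nmem m' 5 \<le> n + 1"
    "nmem m' 6 = nmem m' 4 * (n + 2) + nmem m' 5" "nmem m' 6 = a * (n + 2) + b + 1"
  using assms by (auto simp: advance_def)

lemma runs_sweep:
  assumes "sweeping u w m0" "nmem m0 6 = 0"
  shows "runs sweep m0 (sweep_cost n) (\<lambda>m. sound m \<and> settled_in m {} 0 0 u w \<and>
     (\<forall>i\<le>n. \<forall>j\<le>n + 1. processed (tabL n m) (tabR n m) (best n m) i j))"
proof -
  define \<mu> where "\<mu> m = (n + 1) * (n + 2) - nmem m 6" for m :: mem
  have exit: "sound m \<and> settled_in m {} 0 0 u w \<and>
     (\<forall>i\<le>n. \<forall>j\<le>n + 1. processed (tabL n m) (tabR n m) (best n m) i j)"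
    if "sweeping u w m" "\<not> bval (NLess ca (NAdd cN (NConst 1))) m" for m
  proof -
    have "nmem m 4 = n + 1" using that by (auto simp: sweeping_def sound_def holds_input_def)
    then have q: "(n + 1) * (n + 2) \<le> nmem m 6" using that(1) by (simp add: sweeping_def)
    have "index i j < nmem m 6" if "i \<le> n" "j \<le> n + 1" for i j
    proof -
      have "index i j \<le> n * (n + 2) + (n + 1)"
        unfolding index_def using that by (intro add_mono mult_le_mono1) auto
      also have "\<dots> < (n + 1) * (n + 2)" by simp
      finally show ?thesis using q by simp
    qed
    then show ?thesis using that(1) by (auto simp: sweeping_def processed_split)
  qed
  have body: "runs (Seq slotL (Seq slotR advance)) m (slot_cost n + (slot_cost n + cost advance))
      (\<lambda>m'. sweeping u w m' \<and> \<mu> m' < \<mu> m)"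
    if J: "sweeping u w m" "bval (NLess ca (NAdd cN (NConst 1))) m" for m
  proof -
    define a b where "a = nmem m 4" and "b = nmem m 5"
    define q where "q = a * (n + 2) + b"
    have m: "sound m" "nmem m 4 = a" "nmem m 5 = b" "nmem m 6 = a * (n + 2) + b" "a \<le> n" "b \<le> n + 1"
      and settled: "settled_in m {} 0 0 u w"
      and old: "\<And>i j. i \<le> n \<Longrightarrow> j \<le> n + 1 \<Longrightarrow> index i j < q \<Longrightarrow> processedL m i j \<and> processedR m i j"
      using J by (auto simp: sweeping_def sound_def holds_input_def a_def b_def q_def)
    show ?thesis
    proof (rule runs_Seq, rule runs_mono[OF runs_slotL[OF m] order_refl], rule runs_Seq)
      fix m1 assume m1: "sound m1 \<and> better m m1 \<and> agree (a * (n + 2) + b) m m1 \<and> processedL m1 (n - a) b"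
      then have n1: "sound m1" "nmem m1 4 = a" "nmem m1 5 = b" "nmem m1 6 = a * (n + 2) + b"
        using m by auto
      show "runs slotR m1 (slot_cost n)
         (\<lambda>m'. runs advance m' (cost advance) (\<lambda>m'. sweeping u w m' \<and> \<mu> m' < \<mu> m))"
      proof (rule runs_mono[OF runs_slotR[OF n1 m(5,6)] order_refl], rule runs_sem)
        show "loop_free advance" by (simp add: advance_def)
        fix m2 assume m2: "sound m2 \<and> better m1 m2 \<and> agree (a * (n + 2) + b) m1 m2 \<and> processedR m2 (n - a) b"
        define m3 where "m3 = sem advance m2"
        have n2: "nmem m2 0 = n" "nmem m2 4 = a" "nmem m2 5 = b" "nmem m2 6 = a * (n + 2) + b"
          using m2 n1 by (auto simp: sound_def holds_input_def)
        note adv = advance_sem[OF n2 m(5,6), folded m3_def]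
        have tabs: "tabL n m3 = tabL n m2" "tabR n m3 = tabR n m2" "best n m3 = best n m2"
          by (auto simp: tabL_def tabR_def best_def adv(1))
        have sound3: "sound m3" using m2 adv(1,2) by (simp add: sound_def holds_input_def tabs)
        have "better m m2" using m1 m2 better_trans by blast
        then have settled3: "settled_in m3 {} 0 0 u w"
          using settled settled_better tabs by simp
        have index_q: "index (n - a) b = q" using m(5) by (simp add: index_def q_def)
        have done3: "processedL m3 i j \<and> processedR m3 i j"
          if ij: "i \<le> n" "j \<le> n + 1" "index i j < q + 1" for i j
        proof -
          have le: "index i j \<le> a * (n + 2) + b" using ij by (simp add: q_def)
          have "processedL m1 i j \<and> processedR m2 i j"
          proof (cases "index i j < q")
            case True
            then show ?thesis using old[OF ij(1,2)] m1 m2 processed_persists[OF _ _ le] by blast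
          next
            case False
            then have "index i j = a * (n + 2) + b" using ij by (simp add: q_def)
            then have "i = n - a" "j = b" using index_inj[OF _ ij(2) m(6) ij(1)] by auto
            then show ?thesis using m1 m2 by auto
          qed
          then have "processedL m2 i j \<and> processedR m2 i j"
            using m2 processed_persists[OF _ _ le] by blast
          then show ?thesis by (simp add: processedL_def processedR_def tabs)
        qed
        have "q < (n + 1) * (n + 2)"
        proof -
          have "q \<le> n * (n + 2) + (n + 1)"
            unfolding q_def using m by (intro add_mono mult_le_mono1) auto
          then show ?thesis by simp
        qed
        then have "\<mu> m3 < \<mu> m" using adv(6) m(4) by (simp add: \<mu>_def q_def)
        moreover have "sweeping u w m3"
          using sound3 settled3 adv done3 by (simp add: sweeping_def q_def)
        ultimately show "sweeping u w (sem advance m2) \<and> \<mu> (sem advance m2) < \<mu> m"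
          by (simp add: m3_def)
      qed
    qed
  qed
  have "\<mu> m0 = (n + 1) * (n + 2)" using assms(2) by (simp add: \<mu>_def)
  moreover have "runs sweep m0 ((\<mu> m0 + 1) *
     (1 + bcost (NLess ca (NAdd cN (NConst 1))) + (slot_cost n + (slot_cost n + cost advance))))
     (\<lambda>m. sound m \<and> settled_in m {} 0 0 u w \<and>
       (\<forall>i\<le>n. \<forall>j\<le>n + 1. processed (tabL n m) (tabR n m) (best n m) i j))"
    unfolding sweep_def
    by (rule runs_While[where J = "sweeping u w" and \<mu> = \<mu>]) (fact assms(1), erule (1) body, erule (1) exit)
  ultimately show ?thesis by (simp only: sweep_cost_def)
qed

lemma runs_find_origin:
  assumes holds_input: "holds_input m0" and zero: "\<And>p. 2 * n + 1 < p \<Longrightarrow> rmem m0 p = 0"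
  shows "runs find_origin m0 (find_cost n) 
    (\<lambda>m. \<exists>i\<le>n. sound m \<and> loaded m i (i + 1) 0 0 \<and> reached i (i + 1) 0 0)"
proof -
  define J where "J m \<longleftrightarrow> holds_input m \<and> rmem m = rmem m0 \<and> nmem m 1 \<le> n \<and> nmem m 3 = nmem m 1 * (n + 2) \<and>
    (\<forall>k\<in>{n - nmem m 1 + 1..n}. 0 \<le> s k)" for m
  define \<mu> where "\<mu> m = n - nmem m 1" for m :: mem
  let ?b = "BAnd (NLess cl cN) (BNot (RLess (rs ci) (RConst 0)))"
  let ?c = "Seq (NStore (NConst 1) (NAdd cl (NConst 1))) (NStore (NConst 3) (NAdd cp width))"
  let ?d = "Seq (NStore (NConst 2) (NAdd ci (NConst 1))) (Seq (NStore (NConst 3) (NAdd cp cj))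
     (Seq (RStore ax (RConst 0)) (RStore ac (RConst 0))))"
  let ?Q = "\<lambda>m. \<exists>i\<le>n. sound m \<and> loaded m i (i + 1) 0 0 \<and> reached i (i + 1) 0 0"
  have body: "runs ?c m (cost ?c) (\<lambda>m'. J m' \<and> \<mu> m' < \<mu> m)" if "J m" "bval ?b m" for m
  proof (rule runs_sem)
    define l where "l = nmem m 1"
    have m: "nmem m 0 = n" "holds_input m" "nmem m 1 = l" "l < n" "rmem m = rmem m0" "nmem m 3 = l * (n + 2)"
      "\<not> rmem m (n - l) < 0" "\<And>k. k \<in> {n - l + 1..n} \<Longrightarrow> 0 \<le> s k"
      using that by (auto simp: J_def holds_input_def l_def)
    have "0 \<le> s (n - l)" using m by (simp add: holds_input_def)
    then have "0 \<le> s k" if "k \<in> {n - (l + 1) + 1..n}" for k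
      using m(8)[of k] that m(4) by (cases "k = n - l") auto
    then show "J (sem ?c m) \<and> \<mu> (sem ?c m) < \<mu> m"
      using m by (auto simp: J_def holds_input_def \<mu>_def)
  qed simp
  have last: "runs ?d m (cost ?d) ?Q" if "J m" "\<not> bval ?b m" for m
  proof (rule runs_sem)
    define l where "l = nmem m 1"
    define i where "i = n - l"
    have m: "nmem m 0 = n" "holds_input m" "nmem m 1 = l" "l \<le> n" "rmem m = rmem m0" "nmem m 3 = l * (n + 2)"
      "l < n \<Longrightarrow> rmem m (n - l) < 0" "\<And>k. k \<in> {n - l + 1..n} \<Longrightarrow> 0 \<le> s k"
      using that by (auto simp: J_def holds_input_def l_def)
    have "s k \<le> 0" if k: "k \<in> {1..i}" for k
    proof -
      have "s k \<le> s i" using k by (intro sorted) (auto simp: i_def)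
      also have "s i < 0" using m(2,4,7) k by (auto simp: i_def holds_input_def)
      finally show ?thesis by simp
    qed
    moreover have "{i<..<i + 1} = {}" by auto
    ultimately have reached: "reached i (i + 1) 0 0"
      using m(8) served_empty by (auto simp: reached_def i_def)
    define m' where "m' = sem ?d m"
    have m': "nmem m' = (nmem m)(2 := i + 1, 3 := l * (n + 2) + (i + 1))"
      "rmem m' = (rmem m)(n + n + 1 := 0, n + n + 2 := 0)"
      using m by (auto simp: m'_def i_def)
    have "loaded m' i (i + 1) 0 0" using m(3,4) by (simp add: loaded_def m' index_def i_def)
    moreover have "holds_input m'" using m(2) by (auto simp: holds_input_def m')
    moreover have "tabL n m' p = 0" "tabR n m' p = 0" "best n m' = 0" for p
      using zero m(5) by (auto simp: tabL_def tabR_def best_def m')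
    ultimately have "sound m' \<and> loaded m' i (i + 1) 0 0"
      by (simp add: sound_def soundL_def soundR_def sound_best_def)
    then show "?Q (sem ?d m)" using reached by (auto simp: m'_def i_def intro!: exI[of _ "n - l"])
  qed simp
  have while: "runs (While ?b ?c) m ((n + 1) * 100) (\<lambda>m. J m \<and> \<not> bval ?b m)" if "J m" for m
  proof (rule runs_mono[OF runs_While[where J = J and \<mu> = \<mu> and Q = "\<lambda>m. J m \<and> \<not> bval ?b m",
        OF that body conjI]])
    have "\<mu> m + 1 \<le> n + 1" by (simp add: \<mu>_def)
    then show "(\<mu> m + 1) * (1 + bcost ?b + cost ?c) \<le> (n + 1) * 100"
      by (rule mult_le_mono) simp
  qed assumption+
  define m1 where "m1 = sem (NStore (NConst 3) (NConst 0)) (sem (NStore (NConst 1) (NConst 0)) m0)"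
  have J1: "J m1" using holds_input by (auto simp: m1_def J_def holds_input_def)
  have "runs (Seq (While ?b ?c) ?d) m1 ((n + 1) * 100 + cost ?d) ?Q"
    by (rule runs_Seq, rule runs_mono[OF while[OF J1] order_refl]) (use last in blast)
  then have "runs find_origin m0 (cost (NStore (NConst 1) (NConst 0)) +
      (cost (NStore (NConst 3) (NConst 0)) + ((n + 1) * 100 + cost ?d))) ?Q"
    unfolding find_origin_def m1_def
    by - (rule runs_Seq, rule runs_sem, simp, rule runs_Seq, rule runs_sem, simp)
  then show ?thesis by (rule runs_mono) (auto simp: find_cost_def)
qed

lemma runs_solve:
  assumes holds_input: "holds_input m0" and zero: "\<And>p. 2 * n + 1 < p \<Longrightarrow> rmem m0 p = 0"
  shows "runs solve m0 (solve_cost n) (\<lambda>m. (\<exists>c x. served {1..n} c x \<and> result m = c + \<bar>x\<bar>) \<and>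
    (\<forall>c x. served {1..n} c x \<longrightarrow> result m \<le> c + \<bar>x\<bar>))"
    (is "runs _ _ _ ?Q")
  unfolding solve_def solve_cost_def
proof (rule runs_Seq, rule runs_mono[OF runs_find_origin[OF holds_input zero] order_refl])
  fix m1 assume "\<exists>i\<le>n. sound m1 \<and> loaded m1 i (i + 1) 0 0 \<and> reached i (i + 1) 0 0"
  then obtain i where m1: "i \<le> n" "sound m1" "loaded m1 i (i + 1) 0 0" "reached i (i + 1) 0 0" by auto
  have empty: "{i<..<Suc i} = {}" by auto
  have process_entry: "runs process_entry m1 (process_cost n)
    (\<lambda>m'. sound m' \<and> better m1 m' \<and> settled_in m' {} 0 0 i (i + 1) \<and> agree (index i (i + 1)) m1 m')"
    unfolding process_cost_def by (rule runs_process_entry[OF m1(2-4,1)]) (auto simp: empty)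
  have final: "runs (RStore (NConst 0) (RSub (RMem abest) (RConst 1))) m 100 ?Q"
    if m: "sound m \<and> settled_in m {} 0 0 i (i + 1) \<and>
      (\<forall>i\<le>n. \<forall>j\<le>n + 1. processed (tabL n m) (tabR n m) (best n m) i j)" for m
  proof (rule runs_mono[OF runs_sem])
    have bound: "0 < best n m \<and> best n m \<le> 1 + (c + \<bar>x\<bar>)" if "served {1..n} c x" for c x
      using m by (intro optimum_bound[OF _ _ that]) auto
    obtain c x where "served {1..n} c x" using ex_served by blast
    then have "0 < best n m" using bound by blast
    then obtain c x where "served {1..n} c x" "best n m = 1 + (c + \<bar>x\<bar>)"
      using m by (auto simp: sound_def sound_best_def)
    moreover have "result (sem (RStore (NConst 0) (RSub (RMem abest) (RConst 1))) m) = best n m - 1"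
      using m by (simp add: result_def best_def sound_def holds_input_def)
    ultimately show "?Q (sem (RStore (NConst 0) (RSub (RMem abest) (RConst 1))) m)"
      using bound by force
  qed auto
  show "runs (Seq process_entry (Seq start_sweep (Seq sweep (RStore (NConst 0) (RSub (RMem abest) (RConst 1))))))
     m1 (process_cost n + (cost start_sweep + (sweep_cost n + 100))) ?Q"
  proof (rule runs_Seq, rule runs_mono[OF process_entry order_refl], rule runs_Seq,
      rule runs_sem, simp add: start_sweep_def, rule runs_Seq,
      rule runs_mono[OF runs_sweep[where u = i and w = "i + 1"] order_refl])
    fix m assume m: "sound m \<and> better m1 m \<and> settled_in m {} 0 0 i (i + 1) \<and> agree (index i (i + 1)) m1 m"
    define m' where "m' = sem start_sweep m"
    have "tabL n m' = tabL n m" "tabR n m' = tabR n m" "best n m' = best n m" "rmem m' = rmem m"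
      "nmem m' = (nmem m)(4 := 0, 5 := 0, 6 := 0)"
      by (auto simp: m'_def start_sweep_def tabL_def tabR_def best_def)
    then show "sweeping i (i + 1) (sem start_sweep m)"
      using m by (simp add: sweeping_def sound_def holds_input_def m'_def[symmetric])
    show "nmem (sem start_sweep m) 6 = 0" by (simp add: start_sweep_def)
  qed (use final in blast)
qed

end

section \<open>Sorting the clients\<close>

definition swap_clients :: com where
  "swap_clients = Seq (RStore ax (rs ca)) (Seq (RStore ca (rs cb)) (Seq (RStore cb rx)
     (Seq (RStore ax (rtau ca)) (Seq (RStore (NAdd cN ca) (rtau cb)) (RStore (NAdd cN cb) rx)))))"

text \<open>
  Exchange sort, with the two nested loops merged into one.
\<close>

definition sort_step :: com where
  "sort_step = Cond (NLess cb (NAdd cN (NConst 1)))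
     (Seq (Cond (RLess (rs cb) (rs ca)) swap_clients Skip) (NStore (NConst 5) (NAdd cb (NConst 1))))
     (Seq (NStore (NConst 4) (NAdd ca (NConst 1))) (NStore (NConst 5) ca))"

definition sort_clients :: com where
  "sort_clients = Seq (NStore (NConst 4) (NConst 1)) (Seq (NStore (NConst 5) (NConst 1))
     (While (NLess ca (NAdd cN (NConst 1))) sort_step))"

definition sort_cost :: "nat \<Rightarrow> nat" where
  "sort_cost n = 100 + ((n + 1) * (n + 3) + 1) * 100"

definition arranged :: "nat \<Rightarrow> real \<Rightarrow> (nat \<Rightarrow> real) \<Rightarrow> (nat \<Rightarrow> real) \<Rightarrow> (nat \<Rightarrow> nat) \<Rightarrow> mem \<Rightarrow> bool" where
  "arranged n v s \<tau> \<pi> m \<longleftrightarrow> nmem m 0 = n \<and> rmem m 0 = v \<and> bij_betw \<pi> {1..n} {1..n} \<and>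
     (\<forall>k\<in>{1..n}. rmem m k = s (\<pi> k) \<and> rmem m (n + k) = \<tau> (\<pi> k)) \<and>
     (\<forall>p>2 * n + 1. rmem m p = 0)"

lemma arranged_swap:
  assumes m: "arranged n v s \<tau> \<pi> m" "nmem m 4 = a" "nmem m 5 = b" "1 \<le> a" "a \<le> n" "1 \<le> b" "b \<le> n"
  defines "m' \<equiv> sem swap_clients m"
  shows "arranged n v s \<tau> (\<pi>(a := \<pi> b, b := \<pi> a)) m'" "nmem m' = nmem m"
    "\<And>k. k \<in> {1..n} \<Longrightarrow> rmem m' k = (if k = b then rmem m a else if k = a then rmem m b else rmem m k)"
proof -
  have n: "nmem m 0 = n" using m(1) by (simp add: arranged_def)
  show nm: "nmem m' = nmem m" by (simp add: m'_def swap_clients_def)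
  have rm: "rmem m' = (rmem m)(n + n + 1 := rmem m (n + a), a := rmem m b, b := rmem m a,
      n + a := rmem m (n + b), n + b := rmem m (n + a))"
    using m(2-) n by (auto simp: m'_def swap_clients_def fun_eq_iff)
  show "rmem m' k = (if k = b then rmem m a else if k = a then rmem m b else rmem m k)"
    if "k \<in> {1..n}" for k
    using that m(4-) by (auto simp: rm)
  have bij: "bij_betw \<pi> {1..n} {1..n}" using m(1) by (simp add: arranged_def)
  have "bij_betw (id(a := b, b := a)) {1..n} {1..n}"
    by (rule bij_betw_byWitness[where f' = "id(a := b, b := a)"]) (use m(4-7) in auto)
  from bij_betw_trans[OF this bij] have "bij_betw (\<pi> \<circ> id(a := b, b := a)) {1..n} {1..n}" .
  moreover have "\<pi> \<circ> id(a := b, b := a) = \<pi>(a := \<pi> b, b := \<pi> a)"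
    by (auto simp: fun_eq_iff)
  ultimately have "bij_betw (\<pi>(a := \<pi> b, b := \<pi> a)) {1..n} {1..n}" by simp
  then show "arranged n v s \<tau> (\<pi>(a := \<pi> b, b := \<pi> a)) m'"
    using m(1,4-7) by (auto simp: arranged_def nm rm)
qed

definition sorting :: "nat \<Rightarrow> real \<Rightarrow> (nat \<Rightarrow> real) \<Rightarrow> (nat \<Rightarrow> real) \<Rightarrow> mem \<Rightarrow> bool" where
  "sorting n v s \<tau> m \<longleftrightarrow> (\<exists>\<pi>. arranged n v s \<tau> \<pi> m) \<and>
     1 \<le> nmem m 4 \<and> nmem m 4 \<le> nmem m 5 \<and> nmem m 5 \<le> n + 1 \<and>
     (\<forall>k l. 1 \<le> k \<and> k < nmem m 4 \<and> k < l \<and> l \<le> n \<longrightarrow> rmem m k \<le> rmem m l) \<and>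
     (\<forall>l. nmem m 4 < l \<and> l < nmem m 5 \<longrightarrow> rmem m (nmem m 4) \<le> rmem m l)"

lemma sort_step_sem:
  assumes "sorting n v s \<tau> m" "nmem m 4 \<le> n"
  defines "m' \<equiv> sem sort_step m" and "\<mu> \<equiv> \<lambda>m :: mem. (n + 1 - nmem m 4) * (n + 3) + (n + 1 - nmem m 5)"
  shows "sorting n v s \<tau> m' \<and> \<mu> m' < \<mu> m"
proof -
  define a b where "a = nmem m 4" and "b = nmem m 5"
  from assms(1) obtain \<pi> where arr: "arranged n v s \<tau> \<pi> m" by (auto simp: sorting_def)
  have n: "nmem m 0 = n" using arr by (simp add: arranged_def)
  have ab: "1 \<le> a" "a \<le> n" "a \<le> b" "b \<le> n + 1"
    and pre: "\<And>k l. 1 \<le> k \<Longrightarrow> k < a \<Longrightarrow> k < l \<Longrightarrow> l \<le> n \<Longrightarrow> rmem m k \<le> rmem m l"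
    and cur: "\<And>l. a < l \<Longrightarrow> l < b \<Longrightarrow> rmem m a \<le> rmem m l"
    using assms(1,2) by (auto simp: sorting_def a_def b_def)
  consider (swap) "b \<le> n" "rmem m b < rmem m a" | (keep) "b \<le> n" "\<not> rmem m b < rmem m a" | (exhausted) "b = n + 1"
    using ab by linarith
  then show ?thesis
  proof cases
    case swap
    define m1 where "m1 = sem swap_clients m"
    note sw = arranged_swap[OF arr a_def[symmetric] b_def[symmetric] ab(1,2) _ swap(1), folded m1_def]
    have m': "rmem m' = rmem m1" "nmem m' = (nmem m)(5 := b + 1)"
      using swap n sw(2) ab by (simp_all add: m'_def sort_step_def m1_def a_def[symmetric] b_def[symmetric])
    have "arranged n v s \<tau> (\<pi>(a := \<pi> b, b := \<pi> a)) m'"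
      using sw ab by (simp add: arranged_def m')
    moreover have "rmem m' k \<le> rmem m' l" if "1 \<le> k" "k < a" "k < l" "l \<le> n" for k l
      using that ab sw(3)[of k] sw(3)[of l] pre[of k l] pre[of k a] pre[of k b] swap by (auto simp: m')
    moreover have "rmem m' a \<le> rmem m' l" if "a < l" "l < b + 1" for l
      using that ab sw(3)[of a] sw(3)[of l] cur[of l] swap by (auto simp: m')
    ultimately show ?thesis
      using ab swap by (auto simp: sorting_def \<mu>_def m' a_def[symmetric] b_def[symmetric])
  next
    case keep
    have m': "rmem m' = rmem m" "nmem m' = (nmem m)(5 := b + 1)"
      using keep n by (simp_all add: m'_def sort_step_def a_def[symmetric] b_def[symmetric])
    have "arranged n v s \<tau> \<pi> m'" using arr by (simp add: arranged_def m')
    moreover have "rmem m' a \<le> rmem m' l" if "a < l" "l < b + 1" for l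
      using that cur[of l] keep by (cases "l = b") (auto simp: m')
    ultimately show ?thesis
      using ab keep pre by (auto simp: sorting_def \<mu>_def m' a_def[symmetric] b_def[symmetric])
  next
    case exhausted
    have m': "rmem m' = rmem m" "nmem m' = (nmem m)(4 := a + 1, 5 := a + 1)"
      using exhausted n by (simp_all add: m'_def sort_step_def a_def[symmetric] b_def[symmetric])
    have "arranged n v s \<tau> \<pi> m'" using arr by (simp add: arranged_def m')
    moreover have "rmem m' k \<le> rmem m' l" if "1 \<le> k" "k < a + 1" "k < l" "l \<le> n" for k l
      using that pre[of k l] cur[of l] exhausted by (cases "k = a") (auto simp: m')
    ultimately have "sorting n v s \<tau> m'" using ab by (auto simp: sorting_def m')
    moreover have "(n + 1 - a) * (n + 3) = (n - a) * (n + 3) + (n + 3)"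
      using ab by (simp add: Suc_diff_le)
    then have "\<mu> m' < \<mu> m" using ab exhausted by (simp add: \<mu>_def m' a_def[symmetric] b_def[symmetric])
    ultimately show ?thesis by simp
  qed
qed

lemma runs_sort_clients:
  assumes "arranged n v s \<tau> id m0"
  shows "runs sort_clients m0 (sort_cost n)
    (\<lambda>m. \<exists>\<pi>. arranged n v s \<tau> \<pi> m \<and> (\<forall>k l. 1 \<le> k \<and> k \<le> l \<and> l \<le> n \<longrightarrow> s (\<pi> k) \<le> s (\<pi> l)))"
    (is "runs _ _ _ ?Q")
proof -
  define \<mu> where "\<mu> m = (n + 1 - nmem m 4) * (n + 3) + (n + 1 - nmem m 5)" for m :: mem
  let ?b = "NLess ca (NAdd cN (NConst 1))"
  define m1 where "m1 = sem (NStore (NConst 5) (NConst 1)) (sem (NStore (NConst 4) (NConst 1)) m0)"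
  have J1: "sorting n v s \<tau> m1"
    unfolding sorting_def
    using assms by (auto simp: m1_def arranged_def intro!: exI[of _ id])
  have body: "runs sort_step m (cost sort_step) (\<lambda>m'. sorting n v s \<tau> m' \<and> \<mu> m' < \<mu> m)"
    if "sorting n v s \<tau> m" "bval ?b m" for m
  proof (rule runs_sem)
    show "loop_free sort_step" by (simp add: sort_step_def swap_clients_def)
    have "nmem m 4 \<le> n" using that by (auto simp: sorting_def arranged_def)
    then show "sorting n v s \<tau> (sem sort_step m) \<and> \<mu> (sem sort_step m) < \<mu> m"
      using sort_step_sem[OF that(1)] by (simp add: \<mu>_def)
  qed
  have exit: "?Q m" if "sorting n v s \<tau> m" "\<not> bval ?b m" for m
  proof -
    from that(1) obtain \<pi> where arr: "arranged n v s \<tau> \<pi> m" by (auto simp: sorting_def)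
    have "nmem m 4 = n + 1" using that arr by (auto simp: sorting_def arranged_def)
    then have "rmem m k \<le> rmem m l" if "1 \<le> k" "k \<le> l" "l \<le> n" for k l
      using \<open>sorting n v s \<tau> m\<close> that by (cases "k = l") (auto simp: sorting_def)
    then have "s (\<pi> k) \<le> s (\<pi> l)" if "1 \<le> k" "k \<le> l" "l \<le> n" for k l
      using arr that by (fastforce simp: arranged_def)
    then show ?thesis using arr by blast
  qed
  have "\<mu> m1 \<le> (n + 1) * (n + 3)" by (simp add: m1_def \<mu>_def)
  then have bound: "(\<mu> m1 + 1) * (1 + bcost ?b + cost sort_step) \<le> ((n + 1) * (n + 3) + 1) * 100"
    by (intro mult_le_mono) (auto simp: sort_step_def swap_clients_def)
  have "runs (While ?b sort_step) m1 (((n + 1) * (n + 3) + 1) * 100) ?Q"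
    by (rule runs_mono[OF runs_While[where J = "sorting n v s \<tau>" and \<mu> = \<mu>, OF J1 body exit] bound])
  then have "runs sort_clients m0 (cost (NStore (NConst 4) (NConst 1)) +
      (cost (NStore (NConst 5) (NConst 1)) + ((n + 1) * (n + 3) + 1) * 100)) ?Q"
    unfolding sort_clients_def m1_def
    by - (rule runs_Seq, rule runs_sem, simp, rule runs_Seq, rule runs_sem, simp)
  then show ?thesis by (rule runs_mono) (auto simp: sort_cost_def)
qed

section \<open>The algorithm\<close>

lemma time_bigo: "(\<lambda>n. real (sort_cost n + solve_cost n)) \<in> O(\<lambda>n. real n ^ 3)"
proof -
  define P where "P = 2 * saturate_step_cost + cost relax_next"
  define D where "D = 1 + bcost (RLess (RConst 0) (RMem (aL cq))) + cost loadL + P"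
  define E where "E = 1 + bcost (NLess ca (NAdd cN (NConst 1))) + cost advance + 2 * D"
  define C where "C = 500 + P + cost start_sweep + E"
  have bound: "sort_cost n + solve_cost n \<le> C * (n + 2) ^ 3" for n
  proof -
    define N where "N = n + 2"
    have N: "1 \<le> N" "1 \<le> N ^ 2" "1 \<le> N ^ 3" "N \<le> N ^ 3" "N ^ 2 \<le> N ^ 3"
      by (auto simp: N_def power_increasing[of 1 3 N, simplified] power_increasing[of 2 3 N, simplified]
        intro: self_le_power power_increasing)
    have process_entry: "process_cost n \<le> P * N"
    proof -
      have "process_cost n \<le> (2 * N) * saturate_step_cost + N * cost relax_next"
        unfolding process_cost_def using N(1) by (intro add_mono mult_le_mono) (auto simp: N_def)
      then show ?thesis by (simp add: P_def algebra_simps)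
    qed
    have slot: "slot_cost n \<le> D * N"
    proof -
      have "D - P \<le> (D - P) * N" using N(1) by simp
      moreover have "slot_cost n = (D - P) + process_cost n" by (simp add: slot_cost_def D_def)
      ultimately have "slot_cost n \<le> (D - P) * N + P * N" using process_entry by linarith
      also have "\<dots> = D * N" by (simp add: D_def add_mult_distrib)
      finally show ?thesis .
    qed
    have sweep: "sweep_cost n \<le> E * N ^ 3"
    proof -
      have "1 + bcost (NLess ca (NAdd cN (NConst 1))) + (slot_cost n + (slot_cost n + cost advance))
        = (E - 2 * D) + 2 * slot_cost n" by (simp add: E_def)
      also have "\<dots> \<le> (E - 2 * D) * N + 2 * (D * N)" using slot N(1) by (intro add_mono) auto
      also have "\<dots> = E * N" by (simp add: E_def add_mult_distrib)
      finally have "sweep_cost n \<le> N ^ 2 * (E * N)"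
        unfolding sweep_cost_def by (intro mult_le_mono) (auto simp: N_def power2_eq_square)
      then show ?thesis by (simp add: power2_eq_square power3_eq_cube mult_ac)
    qed
    have "sort_cost n \<le> 200 * N ^ 3"
    proof -
      have "sort_cost n = 100 + 100 * N ^ 2"
        by (simp add: sort_cost_def N_def power2_eq_square algebra_simps)
      then show ?thesis using N by linarith
    qed
    moreover have "find_cost n \<le> 200 * N ^ 3"
      using N by (simp add: find_cost_def N_def)
    moreover have "process_cost n \<le> P * N ^ 3"
      using process_entry N(4) mult_le_mono2[of N "N ^ 3" P] by linarith
    moreover have "cost start_sweep \<le> cost start_sweep * N ^ 3" "100 \<le> 100 * N ^ 3"
      using N(3) by auto
    ultimately have "sort_cost n + solve_cost n
        \<le> 200 * N ^ 3 + (200 * N ^ 3 + (P * N ^ 3 + (cost start_sweep * N ^ 3 + (E * N ^ 3 + 100 * N ^ 3))))"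
      unfolding solve_cost_def using sweep by (intro add_mono)
    also have "\<dots> = C * N ^ 3" by (simp add: C_def algebra_simps)
    finally show ?thesis by (simp add: N_def)
  qed
  show ?thesis
  proof (rule bigoI[where c = "real C * 27"], rule eventually_mono[OF eventually_ge_at_top[of 1]])
    fix n :: nat assume "1 \<le> n"
    then have "C * (n + 2) ^ 3 \<le> C * (3 * n) ^ 3" by (intro mult_le_mono2 power_mono) auto
    also have "C * (3 * n) ^ 3 = C * 27 * n ^ 3" by (simp add: power_mult_distrib)
    finally have "sort_cost n + solve_cost n \<le> C * 27 * n ^ 3"
      using bound[of n] by linarith
    then have "real (sort_cost n + solve_cost n) \<le> real (C * 27 * n ^ 3)" by (rule of_nat_mono)
    then show "norm (real (sort_cost n + solve_cost n)) \<le> real C * 27 * norm (real n ^ 3)" by simp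
  qed
qed

lemma arranged_input:
  assumes "length cs = n"
  shows "arranged n (speed I) (\<lambda>k. start I (cs ! (k - 1))) (\<lambda>k. proc_time I (cs ! (k - 1))) id (input_mem I cs)"
  using assms by (auto simp: arranged_def input_mem_def Let_def)

theorem theorem5:
  "\<exists>(P :: com) (f :: nat \<Rightarrow> nat).
     (\<lambda>n. real (f n)) \<in> O(\<lambda>n. real n ^ 3) \<and>
     (\<forall>(I :: 'a cltsp) cs.
        cltsp_instance I \<and> no_time_constraints I \<and> slow_clients I \<and>
        distinct cs \<and> set cs = clients I \<longrightarrow>
        (\<exists>k m S. exec P (input_mem I cs) k m \<and> k \<le> f (num_clients I) \<and>
           is_arg_min makespan (feasible I) S \<and> result m = makespan S))"
proof (rule exI[of _ "Seq sort_clients solve"], rule exI[of _ "\<lambda>n. sort_cost n + solve_cost n"],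
    rule conjI[OF time_bigo], intro allI impI)
  fix I :: "'a cltsp" and cs
  assume I: "cltsp_instance I \<and> no_time_constraints I \<and> slow_clients I \<and> distinct cs \<and> set cs = clients I"
  define n where "n = num_clients I"
  have n: "length cs = n" using I distinct_card[of cs] by (simp add: n_def num_clients_def)
  let ?s = "\<lambda>k. start I (cs ! (k - 1))" and ?\<tau> = "\<lambda>k. proc_time I (cs ! (k - 1))"
  have "runs (Seq sort_clients solve) (input_mem I cs) (sort_cost n + solve_cost n)
     (\<lambda>m. \<exists>S. is_arg_min makespan (feasible I) S \<and> result m = makespan S)"
  proof (rule runs_Seq, rule runs_mono[OF runs_sort_clients[OF arranged_input[OF n, of I]] order_refl])
    fix m assume "\<exists>\<pi>. arranged n (speed I) ?s ?\<tau> \<pi> m \<and> (\<forall>k l. 1 \<le> k \<and> k \<le> l \<and> l \<le> n \<longrightarrow> ?s (\<pi> k) \<le> ?s (\<pi> l))"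
    then obtain \<pi> where arr: "arranged n (speed I) ?s ?\<tau> \<pi> m"
      and sorted: "\<And>k l. 1 \<le> k \<Longrightarrow> k \<le> l \<Longrightarrow> l \<le> n \<Longrightarrow> ?s (\<pi> k) \<le> ?s (\<pi> l)" by blast
    define client where "client k = cs ! (\<pi> k - 1)" for k
    have "bij_betw (\<lambda>k. k - 1) {1..n} {..<n}"
      by (rule bij_betw_byWitness[where f' = Suc]) auto
    then have "bij_betw ((!) cs \<circ> (\<lambda>k. k - 1)) {1..n} (clients I)"
      using I n by (auto intro!: bij_betw_trans bij_betw_nth)
    then have bij: "bij_betw client {1..n} (clients I)"
      using bij_betw_trans[of \<pi> "{1..n}" "{1..n}" "(!) cs \<circ> (\<lambda>k. k - 1)"] arr
      by (simp add: arranged_def client_def[abs_def] comp_def)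
    interpret unconstrained I client
      using I bij by unfold_locales (auto simp: n_def)
    interpret sorted_line "num_clients I" "speed I" "\<lambda>k. start I (client k)" "\<lambda>k. proc_time I (client k)"
      using sorted by unfold_locales (auto simp: n_def client_def)
    have "holds_input m" unfolding holds_input_def using arr by (auto simp: arranged_def n_def client_def)
    moreover have "rmem m p = 0" if "2 * num_clients I + 1 < p" for p
      using arr that by (auto simp: arranged_def n_def)
    ultimately show "runs solve m (solve_cost n)
        (\<lambda>m. \<exists>S. is_arg_min makespan (feasible I) S \<and> result m = makespan S)"
      unfolding n_def
    proof (rule runs_mono[OF runs_solve order_refl])
      fix m assume m: "(\<exists>c x. served {1..num_clients I} c x \<and> result m = c + \<bar>x\<bar>) \<and>
        (\<forall>c x. served {1..num_clients I} c x \<longrightarrow> result m \<le> c + \<bar>x\<bar>)"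
      then obtain S where S: "feasible I S" "makespan S = result m"
        using served_feasible by metis
      have "makespan S \<le> makespan S'" if "feasible I S'" for S'
        using feasible_served[OF that] m S(2) by force
      then show "\<exists>S. is_arg_min makespan (feasible I) S \<and> result m = makespan S"
        using S by (auto simp: is_arg_min_def not_less intro!: exI[of _ S])
    qed
  qed
  then show "\<exists>k m S. exec (Seq sort_clients solve) (input_mem I cs) k m \<and>
      k \<le> sort_cost (num_clients I) + solve_cost (num_clients I) \<and>
      is_arg_min makespan (feasible I) S \<and> result m = makespan S"
    unfolding runs_def n_def by blast
qed

end
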